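(* Suppose that the problem of minimizing $f(x)$ subject to $Ax=b$ is solvable (in the sense defined in the context). Then for any initialization $v^0\in\mathbf{R}^n$ and any hyperparameters $\eta>0$, $D>0$, $\epsilon>0$, $R\in\{1,2,\dots\}$, $M_{\max}\in\{0,1,2,\dots\}$, the iterates of the A2DR algorithm satisfy $$\liminf_{k\to\infty}\|r^k\|_2=0,$$ and the AA candidates are adopted infinitely often. Additionally, if $F_{\rm DRS}$ has a fixed point, then $v^k$ converges to a fixed point of $F_{\rm DRS}$ and $x^{k+1/2}$ converges to a solution of the problem (minimize $f(x)$ subject to $Ax=b$) as $k\to\infty$.
   Context: **Problem.** Minimize $f(x)$ subject to $Ax=b$, with variable $x=(x_1,\dots,x_N)\in\mathbf{R}^n$, $x_i\in\mathbf{R}^{n_i}$, $n=\sum_i n_i$. Here $f(x)=\sum_{i=1}^N f_i(x_i)$, each $f_i:\mathbf{R}^{n_i}\to\mathbf{R}\cup\{+\infty\}$ is convex, closed and proper, $A=[A_1\ \cdots\ A_N]\in\mathbf{R}^{m\times n}$, $b\in\mathbf{R}^m$, and the linear system $Ax=b$ is assumed feasible. A solution is an optimal point of this problem. **Solvable / pathological.** Let $f^*(y)=\sup_{x\in\mathrm{dom} f}(y^Tx-f(x))$, and for sets $C,C'$ let $\mathrm{dist}(C,C')=\inf\{\|c-c'\|_2: c\in C, c'\in C'\}$. The problem is primal strongly infeasible if $\mathrm{dist}(\mathrm{dom} f,\{x: Ax=b\})>0$, and dual strongly infeasible if $\mathrm{dist}(\mathrm{dom} f^*,\mathrm{range}(A^T))>0$.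 It is pathological if it is primal or dual strongly infeasible, and solvable otherwise. **DRS mapping.** Fix $t>0$. Let $\mathrm{prox}_{tf}(v)=\mathrm{argmin}_x\,(f(x)+\frac1{2t}\|x-v\|_2^2)$ and $\Pi(v)=v-A^\dagger(Av-b)$ (projection onto $\{x:Ax=b\}$; $A^\dagger$ is the pseudoinverse). Define $F_{\rm DRS}(v)=v+\Pi(2\,\mathrm{prox}_{tf}(v)-v)-\mathrm{prox}_{tf}(v)$ and $G_{\rm DRS}(v)=v-F_{\rm DRS}(v)$. **A2DR algorithm.** Inputs: $v^0\in\mathbf{R}^n$, $t>0$, $\eta>0$, $D>0$, $\epsilon>0$, $R\in\{1,2,\dots\}$, $M_{\max}\in\{0,1,2,\dots\}$. Initialize $n_{\rm AA}=0$, $R_{\rm AA}=0$, $I=\text{True}$. Set $v^1=v_{\rm DRS}^1=F_{\rm DRS}(v^0)$, $g^0=v^0-v^1$. For $k=1,2,\dots$: 1. Set $M^k=\min(M_{\max},k)$, $v_{\rm DRS}^{k+1}=F_{\rm DRS}(v^k)$, $g^k=v^k-v_{\rm DRS}^{k+1}$. 2. With $y^j=g^{j+1}-g^j$ and $s^j=v^{j+1}-v^j$, set $Y_k=[y^{k-M^k}\ \cdots\ y^{k-1}]$, $S_k=[s^{k-M^k}\ \cdots\ s^{k-1}]$. 3. Let $\gamma^k=(\gamma^k_0,\dots,\gamma^k_{M^k-1})$ minimize $\|g^k-Y_k\gamma\|_2^2+\eta(\|S_k\|_F^2+\|Y_k\|_F^2)\|\gamma\|_2^2$ over $\gamma$ (if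 $S_k=Y_k=0$ any choice gives the same $v_{\rm AA}^{k+1}$ below). Set $\alpha_0^k=\gamma_0^k$, $\alpha_i^k=\gamma_i^k-\gamma_{i-1}^k$ for $1\le i\le M^k-1$, $\alpha_{M^k}^k=1-\gamma_{M^k-1}^k$ (if $M^k=0$, $\alpha^k_0=1$). 4. AA candidate: $v_{\rm AA}^{k+1}=\sum_{j=0}^{M^k}\alpha_j^k v_{\rm DRS}^{k-M^k+j+1}$. 5. Safeguard. If $I$ is True or $R_{\rm AA}\ge R$: if $\|g^k\|_2\le D\|g^0\|_2(n_{\rm AA}/R+1)^{-(1+\epsilon)}$, set $v^{k+1}=v_{\rm AA}^{k+1}$, $n_{\rm AA}\leftarrow n_{\rm AA}+1$, $I=\text{False}$, $R_{\rm AA}=1$; otherwise set $v^{k+1}=v_{\rm DRS}^{k+1}$, $R_{\rm AA}=0$, $I=\text{True}$. If instead $I$ is False and $R_{\rm AA}<R$: set $v^{k+1}=v_{\rm AA}^{k+1}$, $n_{\rm AA}\leftarrow n_{\rm AA}+1$, $R_{\rm AA}\leftarrow R_{\rm AA}+1$. The algorithm is run without a stopping test, producing infinite sequences. "The AA candidate is adopted at iteration $k$" means step 5 sets $v^{k+1}=v_{\rm AA}^{k+1}$. **Residuals.** $x^{k+1/2}=\mathrm{prox}_{tf}(v^k)$; $r_{\rm prim}^k=Ax^{k+1/2}-b$; $r_{\rm dual}^k=\frac1t(v^k-x^{k+1/2})+A^T\lambda^k$, where $\lambda^k=\frac1t(A^\dagger)^T(x^{k+1/2}-v^k)$ is a minimizer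 over $\lambda$ of $\|\frac1t(v^k-x^{k+1/2})+A^T\lambda\|_2$; and $r^k=(r_{\rm prim}^k,r_{\rm dual}^k)\in\mathbf{R}^{n+m}$. *)

theory Defs
  imports "HOL-Analysis.Analysis"
begin

section \<open>Extended-valued convex functions\<close>

text \<open>Functions into \<open>\<real> \<union> {+\<infinity>}\<close> are \<open>ereal\<close>-valued functions; excluding the value
  \<open>-\<infinity>\<close> is part of properness. The carrier \<open>S\<close> is the space on which the function lives;
  its values outside \<open>S\<close> are irrelevant.\<close>

definition eepigraph :: "'a set \<Rightarrow> ('a \<Rightarrow> ereal) \<Rightarrow> ('a \<times> real) set" where
  "eepigraph S f = {(x, r). x \<in> S \<and> f x \<le> ereal r}"

definition proper_on :: "'a set \<Rightarrow> ('a \<Rightarrow> ereal) \<Rightarrow> bool" where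
  "proper_on S f \<longleftrightarrow> (\<forall>x\<in>S. f x \<noteq> -\<infinity>) \<and> (\<exists>x\<in>S. f x < \<infinity>)"

definition convex_closed_proper_on :: "'a::real_normed_vector set \<Rightarrow> ('a \<Rightarrow> ereal) \<Rightarrow> bool" where
  "convex_closed_proper_on S f \<longleftrightarrow>
     convex (eepigraph S f) \<and> closed (eepigraph S f) \<and> proper_on S f"

definition edom :: "('a \<Rightarrow> ereal) \<Rightarrow> 'a set" where
  "edom f = {x. f x < \<infinity>}"

definition conjugate :: "('a::real_inner \<Rightarrow> ereal) \<Rightarrow> 'a \<Rightarrow> ereal" where
  "conjugate f y = (SUP x\<in>edom f. ereal (y \<bullet> x) - f x)"

definition prox :: "real \<Rightarrow> ('a::real_inner \<Rightarrow> ereal) \<Rightarrow> 'a \<Rightarrow> 'a" where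
  "prox t f v = arg_min (\<lambda>x. f x + ereal (1 / (2 * t) * (norm (x - v))\<^sup>2)) (\<lambda>_. True)"

section \<open>Block structure\<close>

text \<open>A map \<open>blk\<close> assigns to each of the \<open>n\<close> coordinates the index of its block. The space
  \<open>\<real>\<^bsup>n\<^sub>i\<^esup>\<close> of block \<open>i\<close> is the coordinate subspace of vectors supported on that block, and
  the part \<open>x\<^sub>i\<close> of \<open>x\<close> is its coordinate projection.\<close>

definition block_space :: "('n::finite \<Rightarrow> 'b) \<Rightarrow> 'b \<Rightarrow> (real^'n) set" where
  "block_space blk i = {x. \<forall>j. blk j \<noteq> i \<longrightarrow> x $ j = 0}"

definition block :: "('n::finite \<Rightarrow> 'b) \<Rightarrow> 'b \<Rightarrow> real^'n \<Rightarrow> real^'n" where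
  "block blk i x = (\<chi> j. if blk j = i then x $ j else 0)"

definition separable ::
  "('n::finite \<Rightarrow> 'b::finite) \<Rightarrow> ('b \<Rightarrow> real^'n \<Rightarrow> ereal) \<Rightarrow> real^'n \<Rightarrow> ereal" where
  "separable blk fs x = (\<Sum>i\<in>UNIV. fs i (block blk i x))"

section \<open>The problem: minimize \<open>f x\<close> subject to \<open>A x = b\<close>\<close>

definition is_solution :: "(real^'n \<Rightarrow> ereal) \<Rightarrow> real^'n^'m \<Rightarrow> real^'m \<Rightarrow> real^'n \<Rightarrow> bool" where
  "is_solution f A b x \<longleftrightarrow> is_arg_min f (\<lambda>z. z \<in> edom f \<and> A *v z = b) x"

text \<open>\<open>setdist\<close> is \<open>0\<close> if one of the sets is empty; for convex closed proper \<open>f\<close> and feasible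
  \<open>A x = b\<close> the sets below are all nonempty.\<close>

definition primal_strongly_infeasible ::
  "(real^'n \<Rightarrow> ereal) \<Rightarrow> real^'n^'m \<Rightarrow> real^'m \<Rightarrow> bool" where
  "primal_strongly_infeasible f A b \<longleftrightarrow> setdist (edom f) {x. A *v x = b} > 0"

definition dual_strongly_infeasible :: "(real^'n \<Rightarrow> ereal) \<Rightarrow> real^'n^'m \<Rightarrow> bool" where
  "dual_strongly_infeasible f A \<longleftrightarrow>
     setdist (edom (conjugate f)) (range (\<lambda>l. transpose A *v l)) > 0"

definition pathological :: "(real^'n \<Rightarrow> ereal) \<Rightarrow> real^'n^'m \<Rightarrow> real^'m \<Rightarrow> bool" where
  "pathological f A b \<longleftrightarrow> primal_strongly_infeasible f A b \<or> dual_strongly_infeasible f A"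

definition solvable :: "(real^'n \<Rightarrow> ereal) \<Rightarrow> real^'n^'m \<Rightarrow> real^'m \<Rightarrow> bool" where
  "solvable f A b \<longleftrightarrow> \<not> pathological f A b"

section \<open>Douglas-Rachford splitting\<close>

text \<open>The Moore-Penrose pseudoinverse, as the unique solution of the four Penrose equations.\<close>

definition pinv :: "real^'n^'m \<Rightarrow> real^'m^'n" where
  "pinv A = (THE X. A ** X ** A = A \<and> X ** A ** X = X \<and>
                    transpose (A ** X) = A ** X \<and> transpose (X ** A) = X ** A)"

definition proj_affine :: "real^'n^'m \<Rightarrow> real^'m \<Rightarrow> real^'n \<Rightarrow> real^'n" where
  "proj_affine A b v = v - pinv A *v (A *v v - b)"

definition F_DRS ::
  "real \<Rightarrow> (real^'n \<Rightarrow> ereal) \<Rightarrow> real^'n^'m \<Rightarrow> real^'m \<Rightarrow> real^'n \<Rightarrow> real^'n" where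
  "F_DRS t f A b v = v + proj_affine A b (2 *\<^sub>R prox t f v - v) - prox t f v"

section \<open>The A2DR algorithm\<close>

text \<open>Everything below is expressed through the sequence \<open>v\<close> of iterates and the mapping
  \<open>F\<close> (to be instantiated with \<open>F_DRS\<close>); thus \<open>v\<^sub>D\<^sub>R\<^sub>S\<close> with index \<open>k + 1\<close> is \<open>F (v k)\<close>,
  and \<open>g\<^sup>k\<close> is \<open>resid F v k\<close>.\<close>

definition resid :: "('a::real_inner \<Rightarrow> 'a) \<Rightarrow> (nat \<Rightarrow> 'a) \<Rightarrow> nat \<Rightarrow> 'a" where
  "resid F v k = v k - F (v k)"

definition mem :: "nat \<Rightarrow> nat \<Rightarrow> nat" where
  "mem Mmax k = min Mmax k"

text \<open>Column \<open>i\<close> of \<open>Y\<^sub>k\<close> and of \<open>S\<^sub>k\<close>, for \<open>i < M\<^sup>k\<close>.\<close>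

definition Ycol :: "('a::real_inner \<Rightarrow> 'a) \<Rightarrow> nat \<Rightarrow> (nat \<Rightarrow> 'a) \<Rightarrow> nat \<Rightarrow> nat \<Rightarrow> 'a" where
  "Ycol F Mmax v k i =
     (let j = k - mem Mmax k + i in resid F v (j + 1) - resid F v j)"

definition Scol :: "nat \<Rightarrow> (nat \<Rightarrow> 'a::real_inner) \<Rightarrow> nat \<Rightarrow> nat \<Rightarrow> 'a" where
  "Scol Mmax v k i = (let j = k - mem Mmax k + i in v (j + 1) - v j)"

text \<open>The regularized least-squares objective. A weight vector in \<open>\<real>\<^bsup>M\<^esup>\<close> is represented by a
  function on \<open>nat\<close> of which only the values at indices below \<open>M\<close> are ever used.\<close>

definition aa_objective ::
  "('a::real_inner \<Rightarrow> 'a) \<Rightarrow> real \<Rightarrow> nat \<Rightarrow> (nat \<Rightarrow> 'a) \<Rightarrow> nat \<Rightarrow> (nat \<Rightarrow> real) \<Rightarrow> real" where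
  "aa_objective F \<eta> Mmax v k \<gamma> =
     (let M = mem Mmax k in
      (norm (resid F v k - (\<Sum>i<M. \<gamma> i *\<^sub>R Ycol F Mmax v k i)))\<^sup>2
      + \<eta> * ((\<Sum>i<M. (norm (Scol Mmax v k i))\<^sup>2) + (\<Sum>i<M. (norm (Ycol F Mmax v k i))\<^sup>2))
          * (\<Sum>i<M. (\<gamma> i)\<^sup>2))"

definition aa_weight :: "nat \<Rightarrow> (nat \<Rightarrow> real) \<Rightarrow> nat \<Rightarrow> real" where
  "aa_weight M \<gamma> j =
     (if M = 0 then 1
      else if j = 0 then \<gamma> 0
      else if j < M then \<gamma> j - \<gamma> (j - 1)
      else 1 - \<gamma> (M - 1))"

definition aa_candidate ::
  "('a::real_inner \<Rightarrow> 'a) \<Rightarrow> nat \<Rightarrow> (nat \<Rightarrow> 'a) \<Rightarrow> (nat \<Rightarrow> real) \<Rightarrow> nat \<Rightarrow> 'a" where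
  "aa_candidate F Mmax v \<gamma> k =
     (let M = mem Mmax k in \<Sum>j\<le>M. aa_weight M \<gamma> j *\<^sub>R F (v (k - M + j)))"

definition safeguard ::
  "('a::real_inner \<Rightarrow> 'a) \<Rightarrow> real \<Rightarrow> real \<Rightarrow> nat \<Rightarrow> (nat \<Rightarrow> 'a) \<Rightarrow> nat \<Rightarrow> nat \<Rightarrow> bool" where
  "safeguard F D \<epsilon> R v nAA k \<longleftrightarrow>
     norm (resid F v k) \<le> D * norm (resid F v 0) * (real nAA / real R + 1) powr (-(1 + \<epsilon>))"

text \<open>\<open>nAA k\<close>, \<open>RAA k\<close> and \<open>I k\<close> are the values of the algorithm's variables at the start of
  iteration \<open>k\<close>, and \<open>\<gamma> k\<close> is the minimizer picked in iteration \<open>k\<close>. The minimizer need not be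
  unique (when \<open>S\<^sub>k\<close> and \<open>Y\<^sub>k\<close> vanish), hence a relation rather than a function.\<close>

definition A2DR_run ::
  "('a::real_inner \<Rightarrow> 'a) \<Rightarrow> real \<Rightarrow> real \<Rightarrow> real \<Rightarrow> nat \<Rightarrow> nat \<Rightarrow> 'a \<Rightarrow>
   (nat \<Rightarrow> 'a) \<Rightarrow> (nat \<Rightarrow> nat \<Rightarrow> real) \<Rightarrow> (nat \<Rightarrow> nat) \<Rightarrow> (nat \<Rightarrow> nat) \<Rightarrow> (nat \<Rightarrow> bool) \<Rightarrow> bool" where
  "A2DR_run F \<eta> D \<epsilon> R Mmax v0 v \<gamma> nAA RAA I \<longleftrightarrow>
     v 0 = v0 \<and> v 1 = F v0 \<and> nAA 1 = 0 \<and> RAA 1 = 0 \<and> I 1 = True \<and>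
     (\<forall>k\<ge>1.
        is_arg_min (aa_objective F \<eta> Mmax v k) (\<lambda>_. True) (\<gamma> k) \<and>
        (if I k \<or> RAA k \<ge> R then
           (if safeguard F D \<epsilon> R v (nAA k) k then
              v (k + 1) = aa_candidate F Mmax v (\<gamma> k) k \<and>
              nAA (k + 1) = nAA k + 1 \<and> I (k + 1) = False \<and> RAA (k + 1) = 1
            else
              v (k + 1) = F (v k) \<and>
              nAA (k + 1) = nAA k \<and> I (k + 1) = True \<and> RAA (k + 1) = 0)
         else
           v (k + 1) = aa_candidate F Mmax v (\<gamma> k) k \<and>
           nAA (k + 1) = nAA k + 1 \<and> I (k + 1) = I k \<and> RAA (k + 1) = RAA k + 1))"

text \<open>Iteration \<open>k\<close> takes one of the two branches that set the next iterate to the AA candidate.\<close>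

definition AA_adopted ::
  "('a::real_inner \<Rightarrow> 'a) \<Rightarrow> real \<Rightarrow> real \<Rightarrow> nat \<Rightarrow>
   (nat \<Rightarrow> 'a) \<Rightarrow> (nat \<Rightarrow> nat) \<Rightarrow> (nat \<Rightarrow> nat) \<Rightarrow> (nat \<Rightarrow> bool) \<Rightarrow> nat \<Rightarrow> bool" where
  "AA_adopted F D \<epsilon> R v nAA RAA I k \<longleftrightarrow>
     k \<ge> 1 \<and> ((I k \<or> RAA k \<ge> R) \<and> safeguard F D \<epsilon> R v (nAA k) k \<or> \<not> (I k \<or> RAA k \<ge> R))"

section \<open>Residuals\<close>

definition r_prim ::
  "real \<Rightarrow> (real^'n \<Rightarrow> ereal) \<Rightarrow> real^'n^'m \<Rightarrow> real^'m \<Rightarrow> real^'n \<Rightarrow> real^'m" where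
  "r_prim t f A b v = A *v prox t f v - b"

definition lambda_dual :: "real \<Rightarrow> (real^'n \<Rightarrow> ereal) \<Rightarrow> real^'n^'m \<Rightarrow> real^'n \<Rightarrow> real^'m" where
  "lambda_dual t f A v = (1 / t) *\<^sub>R (transpose (pinv A) *v (prox t f v - v))"

definition r_dual ::
  "real \<Rightarrow> (real^'n \<Rightarrow> ereal) \<Rightarrow> real^'n^'m \<Rightarrow> real^'n \<Rightarrow> real^'n" where
  "r_dual t f A v = (1 / t) *\<^sub>R (v - prox t f v) + transpose A *v lambda_dual t f A v"

text \<open>The norm of a pair is the Euclidean norm of the stacked vector.\<close>

definition residual ::
  "real \<Rightarrow> (real^'n \<Rightarrow> ereal) \<Rightarrow> real^'n^'m \<Rightarrow> real^'m \<Rightarrow> real^'n \<Rightarrow> (real^'m) \<times> (real^'n)" where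
  "residual t f A b v = (r_prim t f A b v, r_dual t f A v)"

end

theory Submission
  imports Defs
begin

text \<open>Comparing the regularised least-squares minimiser with the zero vector shows that an Anderson
  step differs from \<open>F\<^sub>D\<^sub>R\<^sub>S (v\<^sup>k)\<close> by at most \<open>\<parallel>g\<^sup>k\<parallel> / \<surd>\<eta>\<close>, and the safeguard makes these
  errors summable. A2DR is therefore an inexact iteration \<open>v\<^sup>k\<^sup>+\<^sup>1 = F\<^sub>D\<^sub>R\<^sub>S (v\<^sup>k) + e\<^sup>k\<close> of a firmly
  nonexpansive map with \<open>\<Sum> \<parallel>e\<^sup>k\<parallel> < \<infinity>\<close>. Its distance to the exact orbit of a point with
  displacement at most \<open>r\<close> converges, which forces \<open>limsup \<parallel>g\<^sup>k\<parallel> \<le> r\<close>; solvability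
  provides such points for every \<open>r > 0\<close>, so \<open>g\<^sup>k \<longlonglongrightarrow> 0\<close>. As the residuals are linear
  images of \<open>g\<^sup>k\<close>, they vanish, and the safeguard cannot fail forever. A fixed point makes the
  iteration quasi-Fejer monotone, hence convergent.\<close>

subsection \<open>Convex closed proper functions\<close>

lemma sum_ereal_not_MInf:
  fixes a :: "'i \<Rightarrow> ereal"
  assumes "\<And>i. i \<in> S \<Longrightarrow> a i \<noteq> -\<infinity>"
  shows "sum a S \<noteq> -\<infinity>"
  using assms by (induction S rule: infinite_finite_induct) auto

text \<open>Serves closedness of separable epigraphs. The induction picks a real \<open>p\<close>
  below the new summand with \<open>c - p\<close> still below the sum of the others.\<close>

lemma ereal_less_sum_split:
  fixes a :: "'i \<Rightarrow> ereal"
  assumes "finite S" "\<And>i. i \<in> S \<Longrightarrow> a i \<noteq> -\<infinity>" "ereal c < sum a S"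
  shows "\<exists>\<rho>. (\<forall>i\<in>S. ereal (\<rho> i) < a i) \<and> c < sum \<rho> S"
  using assms
proof (induction S arbitrary: c rule: finite_induct)
  case empty
  then show ?case by simp
next
  case (insert j S)
  have *: "\<exists>p. ereal p < a j \<and> ereal (c - p) < sum a S"
  proof (cases "sum a S")
    case (real s)
    then have "ereal (c - s) < a j"
      using insert.prems insert.hyps by (cases "a j") auto
    then obtain p where "ereal (c - s) < ereal p" "ereal p < a j"
      using ereal_dense2 by blast
    then show ?thesis using real by (intro exI[of _ p]) auto
  next
    case PInf
    have "-\<infinity> < a j" using insert.prems by (simp add: less_ereal.simps)
    then obtain p where "ereal p < a j"
      using ereal_dense2 by blast
    then show ?thesis using PInf by auto
  next
    case MInf
    then show ?thesis using insert.prems sum_ereal_not_MInf[of S a] by auto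
  qed
  then obtain p where p: "ereal p < a j" "ereal (c - p) < sum a S" by blast
  then obtain \<rho> where \<rho>: "\<forall>i\<in>S. ereal (\<rho> i) < a i" "c - p < sum \<rho> S"
    using insert.IH[of "c - p"] insert.prems by blast
  have "sum (\<rho>(j := p)) (insert j S) = p + sum \<rho> S"
    using insert.hyps by (auto intro: sum.cong)
  then show ?case
    using p \<rho> insert.hyps by (intro exI[of _ "\<rho>(j := p)"]) auto
qed

lemma proper_onD: "proper_on S f \<Longrightarrow> x \<in> S \<Longrightarrow> f x \<noteq> -\<infinity>"
  by (simp add: proper_on_def)

lemma block_in_block_space: "block blk i x \<in> block_space blk i"
  by (simp add: block_def block_space_def)

lemma linear_block: "linear (block blk i)"
  by (rule linearI) (auto simp: block_def vec_eq_iff)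

text \<open>Convexity is checked block by block on finite values, closedness through openness of the
  complement; a point of finite value is glued from one point per block.\<close>

lemma separable_convex_closed_proper:
  fixes blk :: "'n::finite \<Rightarrow> 'b::finite"
  assumes fs: "\<And>i. convex_closed_proper_on (block_space blk i) (fs i)"
  shows "convex_closed_proper_on UNIV (separable blk fs)"
proof -
  have proper: "proper_on (block_space blk i) (fs i)" for i
    using fs by (simp add: convex_closed_proper_on_def)
  have ninf: "fs i (block blk i x) \<noteq> -\<infinity>" for i x
    using proper proper_onD block_in_block_space by metis
  have finite_part: "\<exists>\<rho>. (\<forall>i. fs i (block blk i x) = ereal (\<rho> i)) \<and> sum \<rho> UNIV \<le> r"
    if "separable blk fs x \<le> ereal r" for x r
  proof -
    have "(\<Sum>i\<in>UNIV. fs i (block blk i x)) \<noteq> \<infinity>"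
      using that by (auto simp: separable_def)
    then have "fs i (block blk i x) \<noteq> \<infinity>" for i
      by (auto simp: sum_Pinfty)
    then have "\<exists>a. fs i (block blk i x) = ereal a" for i
      using ninf[of i x] by (cases "fs i (block blk i x)") auto
    then obtain \<rho> where "\<And>i. fs i (block blk i x) = ereal (\<rho> i)" by metis
    with that show ?thesis by (intro exI[of _ \<rho>]) (auto simp: separable_def)
  qed
  have "convex (eepigraph UNIV (separable blk fs))"
  proof (rule convexI)
    fix p q :: "(real^'n) \<times> real" and u w :: real
    assume p: "p \<in> eepigraph UNIV (separable blk fs)" and q: "q \<in> eepigraph UNIV (separable blk fs)"
      and uw: "0 \<le> u" "0 \<le> w" "u + w = 1"
    obtain x r y s where pq: "p = (x, r)" "q = (y, s)" by fastforce
    obtain \<rho> where \<rho>: "\<And>i. fs i (block blk i x) = ereal (\<rho> i)" "sum \<rho> UNIV \<le> r"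
      using finite_part[of x r] p pq by (auto simp: eepigraph_def)
    obtain \<sigma> where \<sigma>: "\<And>i. fs i (block blk i y) = ereal (\<sigma> i)" "sum \<sigma> UNIV \<le> s"
      using finite_part[of y s] q pq by (auto simp: eepigraph_def)
    have "fs i (block blk i (u *\<^sub>R x + w *\<^sub>R y)) \<le> ereal (u * \<rho> i + w * \<sigma> i)" for i
    proof -
      have "convex (eepigraph (block_space blk i) (fs i))"
        using fs by (simp add: convex_closed_proper_on_def)
      moreover have "(block blk i x, \<rho> i) \<in> eepigraph (block_space blk i) (fs i)"
        "(block blk i y, \<sigma> i) \<in> eepigraph (block_space blk i) (fs i)"
        using \<rho> \<sigma> block_in_block_space by (auto simp: eepigraph_def)
      ultimately have "u *\<^sub>R (block blk i x, \<rho> i) + w *\<^sub>R (block blk i y, \<sigma> i)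
          \<in> eepigraph (block_space blk i) (fs i)"
        using uw by (intro convexD) auto
      then show ?thesis
        by (simp add: eepigraph_def linear_add[OF linear_block] linear_scale[OF linear_block])
    qed
    then have "separable blk fs (u *\<^sub>R x + w *\<^sub>R y) \<le> (\<Sum>i\<in>UNIV. ereal (u * \<rho> i + w * \<sigma> i))"
      unfolding separable_def by (intro sum_mono) auto
    also have "\<dots> = ereal (u * sum \<rho> UNIV + w * sum \<sigma> UNIV)"
      by (simp add: sum.distrib sum_distrib_left)
    also have "\<dots> \<le> ereal (u * r + w * s)"
      using uw \<rho> \<sigma> by (auto intro!: add_mono mult_left_mono)
    finally show "u *\<^sub>R p + w *\<^sub>R q \<in> eepigraph UNIV (separable blk fs)"
      by (simp add: pq eepigraph_def)
  qed
  moreover have "closed (eepigraph UNIV (separable blk fs))"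
    unfolding closed_def
  proof (subst open_subopen, intro ballI)
    fix p assume p: "p \<in> - eepigraph UNIV (separable blk fs)"
    obtain x r where xr: "p = (x, r)" by fastforce
    have "ereal r < (\<Sum>i\<in>UNIV. fs i (block blk i x))"
      using p xr by (auto simp: eepigraph_def separable_def)
    then obtain \<rho> where \<rho>: "\<And>i. ereal (\<rho> i) < fs i (block blk i x)" "r < sum \<rho> UNIV"
      using ereal_less_sum_split[of UNIV "\<lambda>i. fs i (block blk i x)" r] ninf by auto
    \<comment> \<open>Over \<open>T\<close> every block value stays above \<open>\<rho> i\<close>
      and the height below their sum, so \<open>T\<close> misses the epigraph.\<close>
    define T where "T = (\<Inter>i. (\<lambda>z. (block blk i (fst z), \<rho> i)) -` (- eepigraph (block_space blk i) (fs i)))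
       \<inter> {z. snd z < sum \<rho> UNIV}"
    have cont: "continuous_on UNIV (\<lambda>z::(real^'n) \<times> real. (block blk i (fst z), \<rho> i))" for i
      by (intro continuous_intros linear_continuous_on_compose[OF _ linear_block])
    have "open T"
      unfolding T_def
      by (intro open_Int open_INT finite ballI open_vimage cont open_Collect_less continuous_intros)
        (use fs in \<open>auto simp: convex_closed_proper_on_def\<close>)
    moreover have "p \<in> T"
      using \<rho> by (auto simp: T_def xr eepigraph_def not_le)
    moreover have "T \<subseteq> - eepigraph UNIV (separable blk fs)"
    proof (rule subsetI)
      fix z assume z: "z \<in> T"
      obtain y s where ys: "z = (y, s)" by fastforce
      have "ereal (\<rho> i) \<le> fs i (block blk i y)" for i
        using z block_in_block_space[of blk i y] by (auto simp: T_def ys eepigraph_def not_le)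
      then have "(\<Sum>i\<in>UNIV. ereal (\<rho> i)) \<le> separable blk fs y"
        unfolding separable_def by (intro sum_mono) auto
      moreover have "s < sum \<rho> UNIV" using z by (simp add: T_def ys)
      ultimately have "ereal s < separable blk fs y"
        by (metis sum_ereal ereal_less(2) less_le_trans less_ereal.simps(1))
      then show "z \<in> - eepigraph UNIV (separable blk fs)"
        by (auto simp: ys eepigraph_def)
    qed
    ultimately show "\<exists>T. open T \<and> p \<in> T \<and> T \<subseteq> - eepigraph UNIV (separable blk fs)" by blast
  qed
  moreover have "proper_on UNIV (separable blk fs)"
  proof -
    have "\<exists>y. y \<in> block_space blk i \<and> fs i y < \<infinity>" for i
      using proper by (auto simp: proper_on_def)
    then obtain y where y: "\<And>i. y i \<in> block_space blk i" "\<And>i. fs i (y i) < \<infinity>" by metis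
    have "block blk i (\<chi> j. y (blk j) $ j) = y i" for i
      using y(1)[of i] by (auto simp: block_def block_space_def vec_eq_iff)
    then have "separable blk fs (\<chi> j. y (blk j) $ j) \<noteq> \<infinity>"
      using y(2) by (auto simp: separable_def sum_Pinfty)
    moreover have "separable blk fs x \<noteq> -\<infinity>" for x
      unfolding separable_def by (rule sum_ereal_not_MInf) (rule ninf)
    ultimately show ?thesis by (auto simp: proper_on_def less_top[symmetric] top_ereal_def)
  qed
  ultimately show ?thesis by (simp add: convex_closed_proper_on_def)
qed

lemma convex_closed_proper_edom:
  assumes "convex_closed_proper_on UNIV f"
  obtains x a where "f x = ereal a"
proof -
  obtain x where "f x < \<infinity>" "f x \<noteq> -\<infinity>"
    using assms by (auto simp: convex_closed_proper_on_def proper_on_def)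
  then show ?thesis using that by (cases "f x") auto
qed

text \<open>A hyperplane separates the epigraph from a point one unit below it. It passes between
  two points over the same \<open>x0\<close>, hence is not vertical: \<alpha> > 0, and division by
  \<alpha> gives the minorant.\<close>

lemma affine_minorant:
  fixes f :: "'a::euclidean_space \<Rightarrow> ereal"
  assumes ccp: "convex_closed_proper_on UNIV f"
  obtains u c where "\<And>x. ereal (c + u \<bullet> x) \<le> f x"
proof -
  obtain x0 a where x0: "f x0 = ereal a" using convex_closed_proper_edom[OF ccp] .
  have "(x0, a - 1) \<notin> eepigraph UNIV f" by (simp add: eepigraph_def x0)
  then obtain d \<beta> where d: "d \<bullet> (x0, a - 1) < \<beta>" "\<And>p. p \<in> eepigraph UNIV f \<Longrightarrow> \<beta> < d \<bullet> p"
    using separating_hyperplane_closed_point[of "eepigraph UNIV f" "(x0, a - 1)"] ccp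
    unfolding convex_closed_proper_on_def by blast
  obtain e \<alpha> where e: "d = (e, \<alpha>)" by fastforce
  have "\<beta> < d \<bullet> (x0, a)" using d(2) by (simp add: eepigraph_def x0)
  then have \<alpha>: "\<alpha> > 0" using d(1) by (simp add: e inner_prod_def algebra_simps)
  have "ereal (\<beta> / \<alpha> + (- (1 / \<alpha>) *\<^sub>R e) \<bullet> x) \<le> f x" for x
  proof (cases "f x")
    case (real r)
    have "\<beta> < e \<bullet> x + \<alpha> * r"
      using d(2)[of "(x, r)"] real by (simp add: eepigraph_def e)
    then show ?thesis using \<alpha> real by (simp add: field_simps)
  next
    case MInf
    then show ?thesis using ccp by (auto simp: convex_closed_proper_on_def proper_on_def)
  qed auto
  then show ?thesis using that by blast
qed

lemma convex_epigraphD: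
  assumes "convex (eepigraph UNIV f)" "f x = ereal p" "f z = ereal q" "0 \<le> s" "s \<le> 1"
  shows "f (x + s *\<^sub>R (z - x)) \<le> ereal (p + s * (q - p))"
proof -
  have "(1 - s) *\<^sub>R (x, p) + s *\<^sub>R (z, q) \<in> eepigraph UNIV f"
    using assms by (intro convexD) (auto simp: eepigraph_def)
  then show ?thesis
    by (simp add: eepigraph_def algebra_simps)
qed

subsection \<open>Minimisation and the proximal mapping\<close>

definition subgradient_at :: "('a::real_inner \<Rightarrow> ereal) \<Rightarrow> 'a \<Rightarrow> 'a \<Rightarrow> bool" where
  "subgradient_at f x u \<longleftrightarrow>
     \<bar>f x\<bar> \<noteq> \<infinity> \<and> (\<forall>z. f x + ereal (u \<bullet> (z - x)) \<le> f z)"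

lemma subgradient_atD:
  assumes "subgradient_at f x u"
  obtains a where "f x = ereal a" "\<And>z. ereal (a + u \<bullet> (z - x)) \<le> f z"
  using assms by (cases "f x") (auto simp: subgradient_at_def)

lemma subgradient_monotone:
  assumes "subgradient_at f x u" "subgradient_at f y w"
  shows "0 \<le> (u - w) \<bullet> (x - y)"
proof -
  obtain a where a: "f x = ereal a" "\<And>z. ereal (a + u \<bullet> (z - x)) \<le> f z"
    using subgradient_atD[OF assms(1)] by blast
  obtain c where c: "f y = ereal c" "\<And>z. ereal (c + w \<bullet> (z - y)) \<le> f z"
    using subgradient_atD[OF assms(2)] by blast
  show ?thesis
    using a(2)[of y] c(2)[of x] a(1) c(1) by (simp add: inner_simps)
qed

text \<open>Direct method on the epigraph, where the objective becomes the continuous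
  \<open>snd p + h (fst p)\<close>. The sublevel set \<open>T\<close> is compact because the
  quadratic growth of \<open>h\<close> beats the affine minorant of \<open>f\<close>.\<close>

lemma exists_minimizer_sum:
  fixes f :: "'a::euclidean_space \<Rightarrow> ereal" and h :: "'a \<Rightarrow> real"
  assumes ccp: "convex_closed_proper_on UNIV f"
    and cont: "continuous_on UNIV h"
    and growth: "\<And>x. \<alpha> * (norm x)\<^sup>2 - \<beta> \<le> h x" and \<alpha>: "\<alpha> > 0"
  obtains x a where "f x = ereal a" "\<And>z. ereal (a + h x) \<le> f z + ereal (h z)"
proof -
  obtain x0 a0 where x0: "f x0 = ereal a0" using convex_closed_proper_edom[OF ccp] .
  obtain u c where minor: "\<And>x. ereal (c + u \<bullet> x) \<le> f x" using affine_minorant[OF ccp] by blast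
  define T where "T = eepigraph UNIV f \<inter> {p. snd p + h (fst p) \<le> a0 + h x0}"
  have conth: "continuous_on UNIV (\<lambda>p::'a \<times> real. snd p + h (fst p))"
    by (intro continuous_intros continuous_on_compose2[OF cont]) auto
  have "closed T"
    unfolding T_def using ccp
    by (intro closed_Int closed_Collect_le conth continuous_on_const)
      (auto simp: convex_closed_proper_on_def)
  moreover have "bounded T"
  proof -
    define K where "K = \<beta> + a0 + h x0 - c"
    \<comment> \<open>Beyond radius \<open>B\<close>, \<open>norm x > 1\<close> and
      \<open>\<alpha> * norm x - norm u > \<bar>K\<bar>\<close>, against
      \<open>quad\<close>.\<close>
    define B where "B = 1 + (norm u + \<bar>K\<bar>) / \<alpha>"
    have B: "norm x \<le> B \<and> \<bar>r\<bar> \<le> \<bar>c\<bar> + norm u * B + \<bar>a0 + h x0 + \<beta>\<bar>" if "(x, r) \<in> T" for x r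
    proof -
      have r: "f x \<le> ereal r" "r + h x \<le> a0 + h x0" using that by (auto simp: T_def eepigraph_def)
      then have lower: "c + u \<bullet> x \<le> r" using minor[of x] order_trans by fastforce
      have cs: "\<bar>u \<bullet> x\<bar> \<le> norm u * norm x" by (rule Cauchy_Schwarz_ineq2)
      have quad: "\<alpha> * (norm x)\<^sup>2 - norm u * norm x \<le> K"
        using growth[of x] r lower cs unfolding K_def by linarith
      have nb: "norm x \<le> B"
      proof (rule ccontr)
        assume "\<not> norm x \<le> B"
        then have "1 + (norm u + \<bar>K\<bar>) / \<alpha> < norm x" by (simp add: B_def)
        moreover have "0 \<le> (norm u + \<bar>K\<bar>) / \<alpha>" using \<alpha> by simp
        ultimately have big: "1 < norm x" "(norm u + \<bar>K\<bar>) / \<alpha> < norm x" by linarith+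
        then have "norm u + \<bar>K\<bar> < \<alpha> * norm x" using \<alpha> by (simp add: field_simps)
        then have "\<bar>K\<bar> < \<alpha> * norm x - norm u" by simp
        also have "\<dots> \<le> (\<alpha> * norm x - norm u) * norm x"
          using big calculation by (simp add: mult_le_cancel_left1)
        also have "\<dots> = \<alpha> * (norm x)\<^sup>2 - norm u * norm x"
          by (simp add: power2_eq_square algebra_simps)
        finally show False using quad by simp
      qed
      then have "norm u * norm x \<le> norm u * B" by (simp add: mult_left_mono)
      moreover have "r \<le> a0 + h x0 + \<beta>"
      proof -
        have "0 \<le> \<alpha> * (norm x)\<^sup>2" using \<alpha> by simp
        then show ?thesis using r(2) growth[of x] by linarith
      qed
      ultimately show ?thesis using nb cs lower by auto
    qed
    have "T \<subseteq> cball 0 B \<times> cball 0 (\<bar>c\<bar> + norm u * B + \<bar>a0 + h x0 + \<beta>\<bar>)"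
      using B by auto
    then show ?thesis
      using bounded_Times bounded_cball bounded_subset by metis
  qed
  ultimately have "compact T" by (simp add: compact_eq_bounded_closed)
  moreover have x0T: "(x0, a0) \<in> T" by (simp add: T_def eepigraph_def x0)
  ultimately obtain p where p: "p \<in> T" "\<And>q. q \<in> T \<Longrightarrow> snd p + h (fst p) \<le> snd q + h (fst q)"
    using continuous_attains_inf[of T "\<lambda>p. snd p + h (fst p)"] continuous_on_subset[OF conth]
    by blast
  \<comment> \<open>Points outside \<open>T\<close> are worse than \<open>(x0, a0)\<close>, so the
    minimum over \<open>T\<close> is global.\<close>
  have opt: "snd p + h (fst p) \<le> r + h z" if "f z = ereal r" for z r
    using that p(2)[of "(z, r)"] p(2)[OF x0T] by (cases "r + h z \<le> a0 + h x0") (auto simp: T_def eepigraph_def)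
  obtain a where a: "f (fst p) = ereal a" "a \<le> snd p"
    using p(1) minor[of "fst p"] by (cases "f (fst p)") (auto simp: T_def eepigraph_def)
  show ?thesis
  proof (rule that[OF a(1)])
    fix z
    show "ereal (a + h (fst p)) \<le> f z + ereal (h z)"
      using opt[of z] a(2) minor[of z] by (cases "f z") fastforce+
  qed
qed

text \<open>Here \<open>u\<close> acts as minus the gradient of \<open>h\<close> at
  \<open>x\<close>. On the segment towards \<open>z\<close>, convexity bounds \<open>f\<close> and
  \<open>diff\<close> bounds \<open>h\<close>; minimality, division by \<open>s\<close> and
  \<open>s \<rightarrow> 0\<close> give the claim.\<close>

lemma minimizer_subgradient:
  assumes conv: "convex (eepigraph UNIV f)" and fin: "f x = ereal a"
    and ninf: "\<And>z. f z \<noteq> -\<infinity>"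
    and opt: "\<And>z. ereal (a + h x) \<le> f z + ereal (h z)"
    and diff: "\<And>z s. h (x + s *\<^sub>R (z - x)) \<le> h x - s * (u \<bullet> (z - x)) + s\<^sup>2 * K z"
  shows "subgradient_at f x u"
proof -
  have "ereal (a + u \<bullet> (z - x)) \<le> f z" for z
  proof (cases "f z")
    case (real q)
    have main: "u \<bullet> (z - x) - (q - a) \<le> s * K z" if s: "0 < s" "s \<le> 1" for s
    proof -
      have le: "f (x + s *\<^sub>R (z - x)) \<le> ereal (a + s * (q - a))"
        using convex_epigraphD[OF conv fin real] s by simp
      have "ereal (a + h x) \<le> f (x + s *\<^sub>R (z - x)) + ereal (h (x + s *\<^sub>R (z - x)))" by (rule opt)
      also have "\<dots> \<le> ereal (a + s * (q - a)) + ereal (h x - s * (u \<bullet> (z - x)) + s\<^sup>2 * K z)"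
        using le diff by (intro add_mono) auto
      finally have "s * (u \<bullet> (z - x) - (q - a)) \<le> s * (s * K z)"
        by (simp add: algebra_simps power2_eq_square)
      then show ?thesis using s by simp
    qed
    have "((\<lambda>s. s * K z) \<longlongrightarrow> 0 * K z) (at_right 0)" by (intro tendsto_intros)
    moreover have "eventually (\<lambda>s. u \<bullet> (z - x) - (q - a) \<le> s * K z) (at_right 0)"
      unfolding eventually_at_right_field by (intro exI[of _ 1]) (auto intro: main)
    ultimately have "u \<bullet> (z - x) - (q - a) \<le> 0 * K z"
      by (intro tendsto_lowerbound) auto
    then show ?thesis using real by simp
  qed (use ninf in auto)
  then show ?thesis by (simp add: subgradient_at_def fin)
qed

text \<open>About \<open>x\<close> the quadratic has slope \<open>- u\<close> plus a positive
  square. The subgradient inequality cancels the slope, so \<open>x\<close> is the unique minimiser,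
  and uniqueness settles the choice in \<open>arg_min\<close>.\<close>

lemma prox_eqI:
  assumes sub: "subgradient_at f x u" and t: "t > 0"
  shows "prox t f (x + t *\<^sub>R u) = x"
proof -
  obtain a where a: "f x = ereal a" "\<And>z. ereal (a + u \<bullet> (z - x)) \<le> f z"
    using subgradient_atD[OF sub] by blast
  define h where "h = (\<lambda>z. 1 / (2 * t) * (norm (z - (x + t *\<^sub>R u)))\<^sup>2)"
  have h: "h z = h x - u \<bullet> (z - x) + 1 / (2 * t) * (norm (z - x))\<^sup>2" for z
    using t unfolding h_def power2_norm_eq_inner
    by (simp add: field_simps) (simp add: algebra_simps inner_commute power2_eq_square)
  have strict: "f x + ereal (h x) < f z + ereal (h z)" if "z \<noteq> x" for z
  proof -
    have "a + h x < a + u \<bullet> (z - x) + h z" using t that by (subst h[of z]) simp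
    then have "ereal (a + h x) < ereal (a + u \<bullet> (z - x)) + ereal (h z)" by simp
    also have "\<dots> \<le> f z + ereal (h z)" by (intro add_mono a(2)) auto
    finally show ?thesis by (simp add: a)
  qed
  have "is_arg_min (\<lambda>z. f z + ereal (h z)) (\<lambda>_. True) z \<longleftrightarrow> z = x" for z
    using strict unfolding is_arg_min_def by (metis less_asym less_irrefl)
  then have "(SOME z. is_arg_min (\<lambda>z. f z + ereal (h z)) (\<lambda>_. True) z) = x" by simp
  then show ?thesis unfolding prox_def arg_min_def h_def .
qed

text \<open>A minimiser exists by quadratic growth and satisfies the first-order condition;
  \<open>prox_eqI\<close> identifies it with the value chosen by \<open>prox\<close>.\<close>

lemma prox_subgradient:
  fixes f :: "'a::euclidean_space \<Rightarrow> ereal"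
  assumes ccp: "convex_closed_proper_on UNIV f" and t: "t > 0"
  shows "subgradient_at f (prox t f v) ((1 / t) *\<^sub>R (v - prox t f v))"
proof -
  define h where "h = (\<lambda>z. 1 / (2 * t) * (norm (z - v))\<^sup>2)"
  have "continuous_on UNIV h" unfolding h_def by (intro continuous_intros)
  moreover have "1 / (4 * t) * (norm z)\<^sup>2 - 1 / (2 * t) * (norm v)\<^sup>2 \<le> h z" for z
  proof -
    have "norm z \<le> norm (z - v) + norm v" by norm
    then have "(norm z)\<^sup>2 \<le> (norm (z - v) + norm v)\<^sup>2" by (rule power_mono) simp
    also have "\<dots> \<le> 2 * (norm (z - v))\<^sup>2 + 2 * (norm v)\<^sup>2"
      using sum_squares_bound[of "norm (z - v)" "norm v"] by (simp add: power2_sum)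
    finally have "1 / (4 * t) * (norm z)\<^sup>2
        \<le> 1 / (4 * t) * (2 * (norm (z - v))\<^sup>2 + 2 * (norm v)\<^sup>2)"
      using t by (intro mult_left_mono) auto
    then show ?thesis unfolding h_def by (simp add: algebra_simps)
  qed
  moreover have "1 / (4 * t) > 0" using t by simp
  ultimately obtain x a where x: "f x = ereal a" "\<And>z. ereal (a + h x) \<le> f z + ereal (h z)"
    using exists_minimizer_sum[OF ccp] by metis
  have "subgradient_at f x ((1 / t) *\<^sub>R (v - x))"
  proof (rule minimizer_subgradient[where f = f and x = x and h = h, OF _ x(1)])
    show "ereal (a + h x) \<le> f z + ereal (h z)" for z by (rule x(2))
    show "convex (eepigraph UNIV f)" "f z \<noteq> -\<infinity>" for z
      using ccp by (auto simp: convex_closed_proper_on_def proper_on_def)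
    show "h (x + s *\<^sub>R (z - x)) \<le> h x - s * ((1 / t) *\<^sub>R (v - x) \<bullet> (z - x))
        + s\<^sup>2 * (1 / (2 * t) * (norm (z - x))\<^sup>2)" for z s
      using t unfolding h_def power2_norm_eq_inner
      by (simp add: field_simps) (simp add: algebra_simps inner_commute power2_eq_square)
  qed
  then show ?thesis
    using prox_eqI[of f x "(1 / t) *\<^sub>R (v - x)" t] t by simp
qed

lemma prox_firmly_nonexpansive:
  fixes f :: "'a::euclidean_space \<Rightarrow> ereal"
  assumes "convex_closed_proper_on UNIV f" and "t > 0"
  shows "0 \<le> ((v - w) - (prox t f v - prox t f w)) \<bullet> (prox t f v - prox t f w)"
proof -
  have "0 \<le> (1 / t) * (((v - w) - (prox t f v - prox t f w)) \<bullet> (prox t f v - prox t f w))"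
    using subgradient_monotone[OF prox_subgradient[OF assms, of v] prox_subgradient[OF assms, of w]]
    by (simp add: inner_simps algebra_simps)
  then show ?thesis using \<open>t > 0\<close> by (simp add: zero_le_mult_iff zero_le_divide_iff)
qed

lemma prox_nonexpansive:
  fixes f :: "'a::euclidean_space \<Rightarrow> ereal"
  assumes "convex_closed_proper_on UNIV f" and "t > 0"
  shows "norm (prox t f v - prox t f w) \<le> norm (v - w)"
proof -
  let ?d = "prox t f v - prox t f w"
  have "norm ?d * norm ?d \<le> (v - w) \<bullet> ?d"
    using prox_firmly_nonexpansive[OF assms, of v w]
    by (simp add: inner_diff_left power2_norm_eq_inner[symmetric] power2_eq_square)
  also have "\<dots> \<le> norm (v - w) * norm ?d" by (rule norm_cauchy_schwarz)
  finally show ?thesis by (metis mult_right_le_imp_le norm_ge_zero norm_not_less_zero order_le_less linorder_not_le)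
qed

subsection \<open>The pseudoinverse\<close>

lemma inner_transpose_mult:
  fixes A :: "real^'n^'m"
  shows "x \<bullet> (transpose A *v y) = (A *v x) \<bullet> y"
  by (metis dot_lmul_matrix inner_commute transpose_matrix_vector)

text \<open>Orthogonal decomposition gives a pointwise choice. Orthogonality determines it uniquely,
  whence linearity, and yields symmetry.\<close>

lemma exists_orthogonal_projection_matrix:
  fixes S :: "(real^'n) set"
  assumes S: "subspace S"
  obtains P :: "real^'n^'n"
  where "transpose P = P" "\<And>x. x \<in> S \<Longrightarrow> P *v x = x" "\<And>x. P *v x \<in> S"
    "\<And>x s. s \<in> S \<Longrightarrow> (x - P *v x) \<bullet> s = 0"
proof -
  have "\<exists>y. y \<in> S \<and> (\<forall>s\<in>S. (x - y) \<bullet> s = 0)" for x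
  proof -
    obtain y z where "y \<in> span S" "\<And>w. w \<in> span S \<Longrightarrow> orthogonal z w" "x = y + z"
      using orthogonal_subspace_decomp_exists[of S x] by blast
    then show ?thesis
      using S by (intro exI[of _ y]) (auto simp: orthogonal_def span_eq_iff[THEN iffD2])
  qed
  then obtain p where p: "\<And>x. p x \<in> S" "\<And>x s. s \<in> S \<Longrightarrow> (x - p x) \<bullet> s = 0" by metis
  have uniq: "p x = y" if y: "y \<in> S" and orth: "\<And>s. s \<in> S \<Longrightarrow> (x - y) \<bullet> s = 0" for x y
  proof -
    have "p x - y \<in> S" using p y S by (simp add: subspace_diff)
    then have "(x - y) \<bullet> (p x - y) = 0" "(x - p x) \<bullet> (p x - y) = 0" using orth p by blast+
    then have "(p x - y) \<bullet> (p x - y) = 0" by (simp add: inner_diff_left)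
    then show ?thesis by simp
  qed
  have lin: "linear p"
  proof (rule linearI)
    show "p (x + y) = p x + p y" for x y
    proof (rule uniq)
      show "p x + p y \<in> S" using p S by (simp add: subspace_add)
      show "(x + y - (p x + p y)) \<bullet> s = 0" if "s \<in> S" for s
        using p(2)[OF that, of x] p(2)[OF that, of y] by (simp add: inner_simps)
    qed
    show "p (c *\<^sub>R x) = c *\<^sub>R p x" for c x
    proof (rule uniq)
      show "c *\<^sub>R p x \<in> S" using p S by (simp add: subspace_scale)
      show "(c *\<^sub>R x - c *\<^sub>R p x) \<bullet> s = 0" if "s \<in> S" for s
        using p(2)[OF that, of x] by (simp add: inner_simps)
    qed
  qed
  then have mv: "matrix p *v x = p x" for x by (simp add: matrix_works)
  have sym: "p x \<bullet> y = x \<bullet> p y" for x y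
    using p(2)[OF p(1)[of y], of x] p(2)[OF p(1)[of x], of y] by (simp add: inner_simps inner_commute)
  have "transpose (matrix p) *v x = matrix p *v x" for x
  proof (rule vector_eq_ldot[THEN iffD1], rule allI)
    show "z \<bullet> (transpose (matrix p) *v x) = z \<bullet> (matrix p *v x)" for z
      unfolding inner_transpose_mult mv by (rule sym)
  qed
  then have "transpose (matrix p) = matrix p" by (simp add: matrix_eq)
  then show ?thesis
    using that[of "matrix p"] p uniq unfolding mv by simp
qed

text \<open>Symmetry swaps factors: \<open>A X = (A Y A X)^T = A X A Y = A Y\<close>, likewise
  \<open>X A = Y A\<close>, so \<open>X = X A X = Y A Y = Y\<close>.\<close>

lemma penrose_unique:
  fixes A :: "real^'n^'m"
  assumes X: "A ** X ** A = A" "X ** A ** X = X" "transpose (A ** X) = A ** X" "transpose (X ** A) = X ** A"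
    and Y: "A ** Y ** A = A" "Y ** A ** Y = Y" "transpose (A ** Y) = A ** Y" "transpose (Y ** A) = Y ** A"
  shows "X = Y"
proof -
  have "A ** X = transpose (A ** Y ** (A ** X))"
    using X by (simp add: matrix_mul_assoc Y)
  also have "\<dots> = A ** X ** (A ** Y)"
    unfolding matrix_transpose_mul[of "A ** Y" "A ** X"] X Y ..
  also have "\<dots> = A ** Y" by (simp add: matrix_mul_assoc X)
  finally have AX: "A ** X = A ** Y" .
  have "X ** A = transpose (X ** A ** (Y ** A))"
    using X by (metis matrix_mul_assoc Y(1))
  also have "\<dots> = Y ** A ** (X ** A)"
    unfolding matrix_transpose_mul[of "X ** A" "Y ** A"] X Y ..
  also have "\<dots> = Y ** A" by (metis matrix_mul_assoc X(1))
  finally have XA: "X ** A = Y ** A" .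
  show ?thesis by (metis AX XA X(2) Y(2) matrix_mul_assoc)
qed

text \<open>With orthogonal projections \<open>Q\<close> onto the range of \<open>A\<close> and
  \<open>P\<close> onto that of its transpose, and \<open>h\<close> a linear right inverse of
  \<open>A\<close> on its range, \<open>X = P h Q\<close> satisfies \<open>A X = Q\<close> and
  \<open>X A = P\<close>.\<close>

lemma penrose_exists:
  fixes A :: "real^'n^'m"
  shows "\<exists>X. A ** X ** A = A \<and> X ** A ** X = X \<and>
             transpose (A ** X) = A ** X \<and> transpose (X ** A) = X ** A"
proof -
  have lin: "linear ((*v) A)" by simp
  have "subspace (range ((*v) A))"
    using linear_subspace_image[OF lin subspace_UNIV] .
  then obtain Q :: "real^'m^'m" where Q: "transpose Q = Q" "\<And>y. y \<in> range ((*v) A) \<Longrightarrow> Q *v y = y"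
    "\<And>y. Q *v y \<in> range ((*v) A)"
    using exists_orthogonal_projection_matrix by metis
  have "subspace (range ((*v) (transpose A)))"
    using linear_subspace_image[OF _ subspace_UNIV] by (metis matrix_vector_mul_linear)
  then obtain P :: "real^'n^'n" where P: "transpose P = P"
    "\<And>x. P *v x \<in> range ((*v) (transpose A))"
    "\<And>x s. s \<in> range ((*v) (transpose A)) \<Longrightarrow> (x - P *v x) \<bullet> s = 0"
    using exists_orthogonal_projection_matrix by metis
  obtain h where h: "linear h" "\<And>y. y \<in> range ((*v) A) \<Longrightarrow> A *v h y = y"
    using linear_exists_right_inverse_on[OF lin subspace_UNIV] by auto
  have AP: "A *v (P *v x) = A *v x" for x
  proof -
    have "(A *v (x - P *v x)) \<bullet> y = 0" for y
      using P(3)[of "transpose A *v y" x] unfolding inner_transpose_mult by blast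
    then have "A *v (x - P *v x) = 0" by (metis inner_eq_zero_iff)
    then show ?thesis by (simp add: matrix_vector_mult_diff_distrib)
  qed
  have Pker: "P *v z = 0" if "A *v z = 0" for z
  proof -
    obtain y where y: "P *v z = transpose A *v y" using P(2)[of z] by blast
    have "(P *v z) \<bullet> (P *v z) = z \<bullet> (P *v z)"
      using P(3)[OF P(2)[of z], of z] by (simp add: inner_diff_left)
    also have "\<dots> = 0" using that unfolding y inner_transpose_mult by simp
    finally show ?thesis by simp
  qed
  have hm: "matrix h *v y = h y" for y by (simp add: matrix_works h(1))
  define X where "X = P ** matrix h ** Q"
  have Xv: "X *v y = P *v h (Q *v y)" for y
    by (simp add: X_def hm flip: matrix_vector_mul_assoc)
  have "(A ** X) *v y = Q *v y" for y
    using h(2)[OF Q(3)] by (simp add: Xv AP flip: matrix_vector_mul_assoc)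
  then have AX: "A ** X = Q" by (simp add: matrix_eq)
  have "(X ** A) *v x = P *v x" for x
  proof -
    have "A *v (h (A *v x) - x) = 0" using h(2) by (simp add: matrix_vector_mult_diff_distrib)
    then have "P *v (h (A *v x) - x) = 0" by (rule Pker)
    then show ?thesis
      using Q(2) by (simp add: Xv matrix_vector_mult_diff_distrib flip: matrix_vector_mul_assoc)
  qed
  then have XA: "X ** A = P" by (simp add: matrix_eq)
  have "(A ** X ** A) *v x = A *v x" for x
    unfolding AX using Q(2) by (simp flip: matrix_vector_mul_assoc)
  then have "A ** X ** A = A" by (simp add: matrix_eq)
  moreover have "(X ** A ** X) *v y = X *v y" for y
  proof -
    have "P *v (z - P *v z) = 0" for z by (rule Pker) (simp add: AP matrix_vector_mult_diff_distrib)
    then have "P *v (P *v z) = P *v z" for z by (simp add: matrix_vector_mult_diff_distrib)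
    then show ?thesis unfolding XA by (simp add: Xv flip: matrix_vector_mul_assoc)
  qed
  then have "X ** A ** X = X" by (simp add: matrix_eq)
  ultimately show ?thesis using AX XA P(1) Q(1) by metis
qed

lemma pinv_penrose:
  fixes A :: "real^'n^'m"
  shows "A ** pinv A ** A = A" "pinv A ** A ** pinv A = pinv A"
    "transpose (pinv A ** A) = pinv A ** A"
proof -
  have "\<exists>!X. A ** X ** A = A \<and> X ** A ** X = X \<and>
             transpose (A ** X) = A ** X \<and> transpose (X ** A) = X ** A"
    using penrose_exists[of A] penrose_unique[of A] by (intro ex_ex1I) blast+
  from theI'[OF this, folded pinv_def]
  show "A ** pinv A ** A = A" "pinv A ** A ** pinv A = pinv A"
    "transpose (pinv A ** A) = pinv A ** A" by auto
qed

text \<open>The orthogonal projection onto the range of \<open>A\<^sup>T\<close>.\<close>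

definition row_proj :: "real^'n^'m \<Rightarrow> real^'n \<Rightarrow> real^'n" where
  "row_proj A x = pinv A *v (A *v x)"

lemma linear_row_proj: "linear (row_proj A)"
  unfolding row_proj_def matrix_vector_mul_assoc by (rule matrix_vector_mul_linear)

lemma row_proj_add: "row_proj A (x + y) = row_proj A x + row_proj A y"
  and row_proj_diff: "row_proj A (x - y) = row_proj A x - row_proj A y"
  and row_proj_scale: "row_proj A (c *\<^sub>R x) = c *\<^sub>R row_proj A x"
  using linear_row_proj[of A] by (auto simp: linear_add linear_diff linear_scale)

lemma mult_row_proj: "A *v row_proj A x = A *v x"
  by (simp add: row_proj_def matrix_vector_mul_assoc matrix_mul_assoc pinv_penrose)

lemma row_proj_idem: "row_proj A (row_proj A x) = row_proj A x"
  unfolding row_proj_def mult_row_proj[unfolded row_proj_def] ..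

lemma row_proj_pinv: "row_proj A (pinv A *v y) = pinv A *v y"
  by (simp add: row_proj_def matrix_vector_mul_assoc matrix_mul_assoc pinv_penrose)

lemma row_proj_transpose: "row_proj A x = transpose A *v (transpose (pinv A) *v x)"
  by (metis row_proj_def matrix_vector_mul_assoc matrix_transpose_mul pinv_penrose(3))

lemma row_proj_sym: "row_proj A x \<bullet> y = x \<bullet> row_proj A y"
proof -
  have "x \<bullet> (transpose (pinv A ** A) *v y) = ((pinv A ** A) *v x) \<bullet> y"
    by (rule inner_transpose_mult)
  then show ?thesis by (simp add: pinv_penrose row_proj_def matrix_vector_mul_assoc)
qed

lemma row_proj_orthogonal: "row_proj A x \<bullet> (y - row_proj A y) = 0"
  by (simp add: row_proj_sym row_proj_diff row_proj_idem)

lemma row_proj_range_transpose: "row_proj A (transpose A *v y) = transpose A *v y"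
proof -
  have "z \<bullet> (transpose A *v y) = (A *v z) \<bullet> y" for z
    by (rule inner_transpose_mult)
  then have "z \<bullet> row_proj A (transpose A *v y) = z \<bullet> (transpose A *v y)" for z
    by (metis row_proj_sym mult_row_proj)
  then show ?thesis by (metis vector_eq_ldot)
qed

lemma row_proj_residual: "row_proj A (x - row_proj A x) = 0"
  by (simp add: row_proj_diff row_proj_idem)

lemma norm_row_proj_split: "(norm x)\<^sup>2 = (norm (row_proj A x))\<^sup>2 + (norm (x - row_proj A x))\<^sup>2"
proof -
  have "norm (row_proj A x + (x - row_proj A x)) ^ 2 = (norm (row_proj A x))\<^sup>2 + (norm (x - row_proj A x))\<^sup>2"
    by (rule norm_add_Pythagorean) (simp add: orthogonal_def row_proj_orthogonal)
  then show ?thesis by simp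
qed

lemma norm_row_proj_le: "norm (row_proj A x) \<le> norm x" "norm (x - row_proj A x) \<le> norm x"
  using norm_row_proj_split[of x A] by (auto intro: power2_le_imp_le)

lemma mult_pinv_feasible: "A *v x = b \<Longrightarrow> A *v (pinv A *v b) = b"
  using mult_row_proj[of A x] by (simp add: row_proj_def)

subsection \<open>The Douglas--Rachford mapping\<close>

text \<open>The first summand lies in the kernel of \<open>A\<close>, the second in the range of its
  transpose. This orthogonal splitting separates dual from primal residual.\<close>

lemma DRS_displacement:
  "v - F_DRS t f A b v =
     ((v - prox t f v) - row_proj A (v - prox t f v)) + (row_proj A (prox t f v) - pinv A *v b)"
proof -
  have "row_proj A (2 *\<^sub>R prox t f v - v) = row_proj A (prox t f v) - row_proj A (v - prox t f v)"
    unfolding row_proj_diff row_proj_scale by (simp add: scaleR_2)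
  moreover have "F_DRS t f A b v = prox t f v - row_proj A (2 *\<^sub>R prox t f v - v) + pinv A *v b"
    by (simp add: F_DRS_def proj_affine_def row_proj_def matrix_vector_mult_diff_distrib scaleR_2)
  ultimately show ?thesis by simp
qed

lemma row_proj_displacement:
  "row_proj A (v - F_DRS t f A b v) = row_proj A (prox t f v) - pinv A *v b"
  unfolding DRS_displacement row_proj_add row_proj_residual
  by (simp add: row_proj_diff row_proj_idem row_proj_pinv)

text \<open>In the notation of the proof, orthogonality in the formula for \<open>g\<close> gives
  \<open>g \<bullet> d - g \<bullet> g = (d - e) \<bullet> e\<close>, which is nonnegative by firm
  nonexpansiveness of the proximal mapping.\<close>

lemma DRS_firmly_nonexpansive:
  fixes A :: "real^'n^'m"
  assumes "convex_closed_proper_on UNIV f" "t > 0"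
  shows "(norm (F_DRS t f A b v - F_DRS t f A b w))\<^sup>2
      + (norm ((v - F_DRS t f A b v) - (w - F_DRS t f A b w)))\<^sup>2 \<le> (norm (v - w))\<^sup>2"
proof -
  define d where "d = v - w"
  define e where "e = prox t f v - prox t f w"
  define g where "g = (v - F_DRS t f A b v) - (w - F_DRS t f A b w)"
  have g: "g = ((d - e) - row_proj A (d - e)) + row_proj A e"
    by (simp add: g_def DRS_displacement d_def e_def row_proj_diff)
  have "0 \<le> (d - e) \<bullet> e"
    unfolding d_def e_def by (rule prox_firmly_nonexpansive[OF assms])
  also have "\<dots> = g \<bullet> d - g \<bullet> g"
    using row_proj_orthogonal[of A "d - e" "d - e"] row_proj_orthogonal[of A "d - e" e]
      row_proj_orthogonal[of A e "d - e"] row_proj_orthogonal[of A e e]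
    unfolding g by (simp add: inner_simps inner_commute)
  finally have "g \<bullet> g \<le> g \<bullet> d" by simp
  moreover have "F_DRS t f A b v - F_DRS t f A b w = d - g" by (simp add: d_def g_def)
  ultimately show ?thesis
    unfolding g_def[symmetric] d_def[symmetric]
    by (simp add: power2_norm_eq_inner inner_simps inner_commute)
qed

lemma residual_displacement:
  assumes "A *v x0 = b"
  shows "r_prim t f A b v = A *v (v - F_DRS t f A b v)"
    and "r_dual t f A v = (1 / t) *\<^sub>R ((v - F_DRS t f A b v) - row_proj A (v - F_DRS t f A b v))"
proof -
  have "A *v (v - F_DRS t f A b v) = A *v (row_proj A (prox t f v) - pinv A *v b)"
    by (metis mult_row_proj row_proj_displacement)
  then show "r_prim t f A b v = A *v (v - F_DRS t f A b v)"
    by (simp add: r_prim_def matrix_vector_mult_diff_distrib mult_row_proj mult_pinv_feasible[OF assms])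
  have "transpose A *v (transpose (pinv A) *v (prox t f v - v)) = - row_proj A (v - prox t f v)"
    unfolding row_proj_transpose[symmetric] by (simp add: row_proj_diff)
  then have "r_dual t f A v = (1 / t) *\<^sub>R ((v - prox t f v) - row_proj A (v - prox t f v))"
    unfolding r_dual_def lambda_dual_def matrix_vector_mult_scaleR
    by (simp add: scaleR_diff_right)
  then show "r_dual t f A v
      = (1 / t) *\<^sub>R ((v - F_DRS t f A b v) - row_proj A (v - F_DRS t f A b v))"
    unfolding row_proj_displacement by (simp add: DRS_displacement)
qed

text \<open>Both orthogonal parts of the displacement vanish. So the proximal point is feasible and
  its subgradient is orthogonal to feasible directions, which removes the linear term from the
  subgradient inequality.\<close>

lemma DRS_fixed_point_solution:
  fixes A :: "real^'n^'m"
  assumes ccp: "convex_closed_proper_on UNIV f" and t: "t > 0" and feas: "A *v x0 = b"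
    and fixed: "F_DRS t f A b w = w"
  shows "is_solution f A b (prox t f w)"
proof -
  let ?x = "prox t f w"
  have Ax: "A *v ?x = b"
    using residual_displacement(1)[OF feas, of t f w] by (simp add: fixed r_prim_def)
  have dual: "w - ?x = row_proj A (w - ?x)"
  proof -
    have "row_proj A ?x - pinv A *v b = 0"
      using row_proj_displacement[of A w t f b] by (simp add: fixed linear_0[OF linear_row_proj])
    then show ?thesis using DRS_displacement[of w t f A b] by (simp add: fixed)
  qed
  obtain a where a: "f ?x = ereal a"
    "\<And>z. ereal (a + ((1 / t) *\<^sub>R (w - ?x)) \<bullet> (z - ?x)) \<le> f z"
    using subgradient_atD[OF prox_subgradient[OF ccp t, of w]] by blast
  have "f ?x \<le> f z" if "A *v z = b" for z
  proof -
    have "row_proj A (z - ?x) = 0"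
      by (simp add: row_proj_def matrix_vector_mult_diff_distrib that Ax)
    then have "(w - ?x) \<bullet> (z - ?x) = 0"
      by (metis dual row_proj_sym inner_zero_right)
    then show ?thesis using a(2)[of z] a(1) by simp
  qed
  then show ?thesis
    by (auto simp: is_solution_def is_arg_min_def edom_def Ax a(1) not_less)
qed

section \<open>Nearly feasible points and small displacements\<close>

text \<open>The slope of an affine minorant belongs to the domain. Since \<open>setdist\<close> is 0
  for empty sets too, nonemptiness is what turns distance 0 into pairs of nearby points.\<close>

lemma edom_conjugate_nonempty:
  fixes f :: "'a::euclidean_space \<Rightarrow> ereal"
  assumes ccp: "convex_closed_proper_on UNIV f"
  shows "edom (conjugate f) \<noteq> {}"
proof -
  obtain u c where minor: "\<And>x. ereal (c + u \<bullet> x) \<le> f x" using affine_minorant[OF ccp] by blast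
  have "ereal (u \<bullet> x) - f x \<le> ereal (- c)" for x
    using minor[of x] by (cases "f x") auto
  then have "conjugate f u \<le> ereal (- c)"
    unfolding conjugate_def by (intro SUP_least) auto
  then have "u \<in> edom (conjugate f)" by (auto simp: edom_def)
  then show ?thesis by blast
qed

text \<open>Fenchel-Young inequality, with \<open>K\<close> a real upper bound of the conjugate at
  \<open>y\<close>.\<close>

lemma conjugate_minorant:
  fixes f :: "'a::euclidean_space \<Rightarrow> ereal"
  assumes ccp: "convex_closed_proper_on UNIV f" and y: "y \<in> edom (conjugate f)"
  obtains K where "\<And>x. ereal (y \<bullet> x - K) \<le> f x"
proof -
  have "conjugate f y < \<infinity>" using y by (simp add: edom_def)
  then obtain K where K: "conjugate f y \<le> ereal K"
    by (cases "conjugate f y") auto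
  have "ereal (y \<bullet> x - K) \<le> f x" for x
  proof (cases "f x")
    case (real r)
    then have "ereal (y \<bullet> x) - f x \<le> conjugate f y"
      unfolding conjugate_def by (intro SUP_upper) (simp add: edom_def)
    then show ?thesis using K real order_trans by fastforce
  qed (use ccp in \<open>auto simp: convex_closed_proper_on_def proper_on_def\<close>)
  then show ?thesis using that by blast
qed

text \<open>The point is found by minimising the penalised function
  \<open>f x + \<parallel>P x - c\<parallel>\<^sup>2 / (2 \<mu>) + \<mu> / 2 \<parallel>x - P x\<parallel>\<^sup>2\<close>, where \<open>P\<close> projects onto the range of \<open>A\<^sup>T\<close>
  and \<open>c = A\<^sup>\<dagger> b\<close>. Comparing its minimum with the value at a nearly feasible point and with the
  affine minorant of a nearly feasible dual point bounds both parts of the displacement.\<close>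

lemma DRS_small_displacement:
  fixes A :: "real^'n^'m" and f :: "real^'n \<Rightarrow> ereal"
  assumes ccp: "convex_closed_proper_on UNIV f" and feas: "\<exists>x. A *v x = b"
    and solv: "solvable f A b" and t: "t > 0" and r: "r > 0"
  shows "\<exists>z. norm (z - F_DRS t f A b z) \<le> r"
proof -
  \<comment> \<open>The final bound on the displacement is
    \<open>3 * (t + 1) * \<delta>\<close>.\<close>
  define \<delta> where "\<delta> = r / (3 * (t + 1))"
  have \<delta>: "\<delta> > 0" using r t by (simp add: \<delta>_def)
  let ?P = "row_proj A" and ?c = "pinv A *v b"
  have "\<not> \<delta> \<le> setdist (edom f) {x. A *v x = b}"
    using solv \<delta> by (simp add: solvable_def pathological_def primal_strongly_infeasible_def)
  moreover have "edom f \<noteq> {}"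
    using ccp by (auto simp: convex_closed_proper_on_def proper_on_def edom_def)
  ultimately obtain x0 z0 where x0: "x0 \<in> edom f" "A *v z0 = b" "dist x0 z0 < \<delta>"
    using le_setdistI[of "edom f" "{x. A *v x = b}" \<delta>] feas by (force simp: not_le)
  obtain a0 where a0: "f x0 = ereal a0"
    using x0(1) ccp by (cases "f x0") (auto simp: edom_def convex_closed_proper_on_def proper_on_def)
  have "?P x0 - ?c = ?P (x0 - z0)" using x0(2) by (simp add: row_proj_diff) (simp add: row_proj_def)
  then have px0: "norm (?P x0 - ?c) \<le> \<delta>"
    using norm_row_proj_le(1)[of A "x0 - z0"] x0(3) by (simp add: dist_norm)
  have "\<not> \<delta> \<le> setdist (edom (conjugate f)) (range (\<lambda>l. transpose A *v l))"
    using solv \<delta> by (simp add: solvable_def pathological_def dual_strongly_infeasible_def)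
  then have "\<exists>y\<in>edom (conjugate f). \<exists>z\<in>range (\<lambda>l. transpose A *v l). dist y z < \<delta>"
    using le_setdistI[of "edom (conjugate f)" "range (\<lambda>l. transpose A *v l)" \<delta>]
      edom_conjugate_nonempty[OF ccp] by (meson not_le UNIV_not_empty image_is_empty)
  then obtain y l where y: "y \<in> edom (conjugate f)" "dist y (transpose A *v l) < \<delta>"
    by blast
  obtain K where K: "\<And>x. ereal (y \<bullet> x - K) \<le> f x"
    using conjugate_minorant[OF ccp y(1)] by blast
  \<comment> \<open>Subtracting a point of the range of the transpose leaves the kernel part of
    \<open>y\<close> unchanged, so nearness to that range bounds it.\<close>
  have ey: "y - ?P y = (y - transpose A *v l) - ?P (y - transpose A *v l)"
    unfolding row_proj_diff row_proj_range_transpose by simp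
  have dy: "norm (y - ?P y) \<le> \<delta>"
    unfolding ey
    using norm_row_proj_le(2)[of "y - transpose A *v l" A] y(2)[unfolded dist_norm] by linarith
  define q0 where "q0 = norm (x0 - ?P x0)"
  define C where "C = a0 + K - y \<bullet> ?c"
  \<comment> \<open>The bound 1 gives \<open>\<mu> \<le> 1 / \<mu>\<close>, the second
    \<open>\<mu> * norm y \<le> \<delta>\<close>, and the third keeps the leftover constants below
    the square of \<delta>.\<close>
  define \<mu> where "\<mu> = min 1 (min (\<delta> / (1 + norm y)) (\<delta>\<^sup>2 / (1 + 2 * \<bar>C\<bar> + q0\<^sup>2)))"
  have den: "0 < 1 + norm y" "0 < 1 + 2 * \<bar>C\<bar> + q0\<^sup>2"
    by (auto intro: add_pos_nonneg)
  have \<mu>: "0 < \<mu>" "\<mu> \<le> 1" using \<delta> den by (auto simp: \<mu>_def)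
  have "\<mu> \<le> \<delta> / (1 + norm y)" "\<mu> \<le> \<delta>\<^sup>2 / (1 + 2 * \<bar>C\<bar> + q0\<^sup>2)" by (auto simp: \<mu>_def)
  then have \<mu>': "\<mu> * (1 + norm y) \<le> \<delta>" "\<mu> * (1 + 2 * \<bar>C\<bar> + q0\<^sup>2) \<le> \<delta>\<^sup>2"
    using den by (simp_all add: pos_le_divide_eq)
  define h where "h = (\<lambda>x. 1 / (2 * \<mu>) * (norm (?P x - ?c))\<^sup>2 + \<mu> / 2 * (norm (x - ?P x))\<^sup>2)"
  have contP: "continuous_on UNIV ?P"
    by (rule linear_continuous_on) (simp add: linear_row_proj linear_linear)
  have "continuous_on UNIV h"
    unfolding h_def by (intro continuous_intros contP)
  moreover have "\<mu> / 4 * (norm x)\<^sup>2 - \<mu> / 2 * (norm ?c)\<^sup>2 \<le> h x" for x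
  proof -
    have "norm (?P x) \<le> norm (?P x - ?c) + norm ?c" by norm
    then have "(norm (?P x))\<^sup>2 \<le> (norm (?P x - ?c) + norm ?c)\<^sup>2" by (rule power_mono) simp
    also have "\<dots> \<le> 2 * (norm (?P x - ?c))\<^sup>2 + 2 * (norm ?c)\<^sup>2"
      using sum_squares_bound[of "norm (?P x - ?c)" "norm ?c"] by (simp add: power2_sum)
    finally have "(norm x)\<^sup>2 \<le> 2 * (norm (?P x - ?c))\<^sup>2 + 2 * (norm ?c)\<^sup>2 + 2 * (norm (x - ?P x))\<^sup>2"
      using norm_row_proj_split[of x A] zero_le_power2[of "norm (x - ?P x)"] by linarith
    then have "\<mu> / 4 * (norm x)\<^sup>2
        \<le> \<mu> / 4 * (2 * (norm (?P x - ?c))\<^sup>2 + 2 * (norm ?c)\<^sup>2 + 2 * (norm (x - ?P x))\<^sup>2)"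
      using \<mu> by (intro mult_left_mono) auto
    moreover have "\<mu> / 2 * (norm (?P x - ?c))\<^sup>2 \<le> 1 / (2 * \<mu>) * (norm (?P x - ?c))\<^sup>2"
      using \<mu> mult_le_one[of \<mu> \<mu>] by (intro mult_right_mono) (auto simp: field_simps)
    ultimately show ?thesis unfolding h_def by (simp add: algebra_simps)
  qed
  moreover have "\<mu> / 4 > 0" using \<mu> by simp
  ultimately obtain x a where x: "f x = ereal a" "\<And>z. ereal (a + h x) \<le> f z + ereal (h z)"
    using exists_minimizer_sum[OF ccp] by metis
  \<comment> \<open>Minus the gradient of \<open>h\<close> at \<open>x\<close>, hence a subgradient
    of \<open>f\<close>; the point sought is \<open>x + t *\<^sub>R u\<close>, whose proximal point
    is \<open>x\<close>.\<close>
  define u where "u = - (1 / \<mu>) *\<^sub>R (?P x - ?c) - \<mu> *\<^sub>R (x - ?P x)"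
  have "subgradient_at f x u"
  proof (rule minimizer_subgradient[where f = f and x = x and h = h, OF _ x(1)])
    show "ereal (a + h x) \<le> f z + ereal (h z)" for z by (rule x(2))
    show "convex (eepigraph UNIV f)" "f z \<noteq> -\<infinity>" for z
      using ccp by (auto simp: convex_closed_proper_on_def proper_on_def)
    show "h (x + s *\<^sub>R (z - x)) \<le> h x - s * (u \<bullet> (z - x))
        + s\<^sup>2 * (1 / (2 * \<mu>) * (norm (?P (z - x)))\<^sup>2 + \<mu> / 2 * (norm ((z - x) - ?P (z - x)))\<^sup>2)" for z s
    proof -
      define d where "d = z - x"
      have expand: "(norm (p + s *\<^sub>R q))\<^sup>2 = (norm p)\<^sup>2 + 2 * s * (p \<bullet> q) + s\<^sup>2 * (norm q)\<^sup>2"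
        for p q :: "real^'n"
        unfolding power2_norm_eq_inner
        by (simp add: inner_simps inner_commute algebra_simps power2_eq_square)
      have "?P (?P x - ?c) = ?P x - ?c" by (simp add: row_proj_diff row_proj_idem row_proj_pinv)
      then have 1: "(?P x - ?c) \<bullet> ?P d = (?P x - ?c) \<bullet> d" by (metis row_proj_sym)
      have 2: "(x - ?P x) \<bullet> (d - ?P d) = (x - ?P x) \<bullet> d"
        using row_proj_orthogonal[of A d x] by (simp add: inner_diff_right inner_commute)
      have "?P (x + s *\<^sub>R d) - ?c = (?P x - ?c) + s *\<^sub>R ?P d"
        "(x + s *\<^sub>R d) - ?P (x + s *\<^sub>R d) = (x - ?P x) + s *\<^sub>R (d - ?P d)"
        by (simp_all add: row_proj_add row_proj_scale algebra_simps)
      then have "h (x + s *\<^sub>R d) = 1 / (2 * \<mu>) * ((norm (?P x - ?c))\<^sup>2 + 2 * s * ((?P x - ?c) \<bullet> d) + s\<^sup>2 * (norm (?P d))\<^sup>2)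
         + \<mu> / 2 * ((norm (x - ?P x))\<^sup>2 + 2 * s * ((x - ?P x) \<bullet> d) + s\<^sup>2 * (norm (d - ?P d))\<^sup>2)"
        by (simp only: h_def expand 1 2)
      also have "\<dots> = h x - s * (u \<bullet> d) + s\<^sup>2 * (1 / (2 * \<mu>) * (norm (?P d))\<^sup>2 + \<mu> / 2 * (norm (d - ?P d))\<^sup>2)"
        unfolding h_def u_def inner_diff_left[of "- (1 / \<mu>) *\<^sub>R (?P x - ?c)"] inner_scaleR_left
        using \<mu> by (simp add: algebra_simps)
      finally show ?thesis by (simp add: d_def)
    qed
  qed
  then have prox: "prox t f (x + t *\<^sub>R u) = x" using t by (rule prox_eqI)
  define p where "p = norm (?P x - ?c)"
  \<comment> \<open>With this scaling, \<open>2 * \<mu>\<close> times the penalty \<open>h x\<close>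
    is the sum of the squares of \<open>p\<close> and \<open>w\<close>.\<close>
  define w where "w = \<mu> * norm (x - ?P x)"
  have pw0: "0 \<le> p" "0 \<le> w" using \<mu> by (simp_all add: p_def w_def)
  have "u - ?P u = - \<mu> *\<^sub>R (x - ?P x)"
  proof -
    have "?P (?P x - ?c) = ?P x - ?c" by (simp add: row_proj_diff row_proj_idem row_proj_pinv)
    then have "?P u = - (1 / \<mu>) *\<^sub>R (?P x - ?c)"
      unfolding u_def row_proj_diff[of A "- (1 / \<mu>) *\<^sub>R (?P x - ?c)"] row_proj_scale row_proj_residual
      by simp
    then show ?thesis by (simp add: u_def)
  qed
  then have "(x + t *\<^sub>R u) - F_DRS t f A b (x + t *\<^sub>R u) = t *\<^sub>R (- \<mu> *\<^sub>R (x - ?P x)) + (?P x - ?c)"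
    unfolding DRS_displacement prox
    by (simp add: row_proj_scale flip: scaleR_diff_right)
  then have "norm ((x + t *\<^sub>R u) - F_DRS t f A b (x + t *\<^sub>R u))
      \<le> norm (t *\<^sub>R (- \<mu> *\<^sub>R (x - ?P x))) + norm (?P x - ?c)"
    by (metis norm_triangle_ineq)
  also have "\<dots> = t * w + p"
    using t \<mu> by (simp add: w_def p_def)
  finally have disp: "norm ((x + t *\<^sub>R u) - F_DRS t f A b (x + t *\<^sub>R u)) \<le> t * w + p" .
  have lower: "y \<bullet> ?c - norm y * p - \<delta> * norm (x - ?P x) - K \<le> a"
  proof -
    have "y \<bullet> x - K \<le> a" using K[of x] x(1) by simp
    moreover have "y \<bullet> x = y \<bullet> ?c + y \<bullet> (?P x - ?c) + (y - ?P y) \<bullet> (x - ?P x)"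
      using row_proj_orthogonal[of A y x] by (simp add: inner_diff_left inner_diff_right)
    moreover have "\<bar>y \<bullet> (?P x - ?c)\<bar> \<le> norm y * p"
      unfolding p_def by (rule Cauchy_Schwarz_ineq2)
    moreover have "\<bar>(y - ?P y) \<bullet> (x - ?P x)\<bar> \<le> \<delta> * norm (x - ?P x)"
      using Cauchy_Schwarz_ineq2[of "y - ?P y" "x - ?P x"] dy
      by (meson mult_right_mono norm_ge_zero order_trans)
    ultimately show ?thesis by linarith
  qed
  have upper: "a + h x \<le> a0 + 1 / (2 * \<mu>) * \<delta>\<^sup>2 + \<mu> / 2 * q0\<^sup>2"
  proof -
    have "(norm (?P x0 - ?c))\<^sup>2 \<le> \<delta>\<^sup>2" using px0 by (intro power_mono) auto
    then have "h x0 \<le> 1 / (2 * \<mu>) * \<delta>\<^sup>2 + \<mu> / 2 * q0\<^sup>2"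
      unfolding h_def q0_def using \<mu> by (intro add_mono mult_left_mono) auto
    then show ?thesis using x(2)[of x0] by (simp add: a0)
  qed
  have "2 * \<mu> * (1 / (2 * \<mu>) * p\<^sup>2 + \<mu> / 2 * (norm (x - ?P x))\<^sup>2)
     \<le> 2 * \<mu> * (C + 1 / (2 * \<mu>) * \<delta>\<^sup>2 + \<mu> / 2 * q0\<^sup>2 + norm y * p + \<delta> * norm (x - ?P x))"
    using \<mu> lower upper unfolding h_def p_def C_def by (intro mult_left_mono) auto
  then have "p\<^sup>2 + w\<^sup>2 \<le> 2 * (\<mu> * C) + \<delta>\<^sup>2 + \<mu> * (\<mu> * q0\<^sup>2) + 2 * (\<mu> * norm y) * p + 2 * \<delta> * w"
    using \<mu> by (simp add: w_def algebra_simps power2_eq_square)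
  also have "\<dots> \<le> 2 * (\<mu> * \<bar>C\<bar>) + \<delta>\<^sup>2 + \<mu> * q0\<^sup>2 + 2 * \<delta> * p + 2 * \<delta> * w"
  proof -
    have "\<mu> * C \<le> \<mu> * \<bar>C\<bar>" using \<mu> by (intro mult_left_mono) auto
    moreover have "\<mu> * (\<mu> * q0\<^sup>2) \<le> 1 * (\<mu> * q0\<^sup>2)" using \<mu> by (intro mult_right_mono) auto
    moreover have "\<mu> * norm y \<le> \<delta>" using \<mu>'(1) \<mu> by (simp add: distrib_left)
    then have "\<mu> * norm y * p \<le> \<delta> * p" using pw0 by (intro mult_right_mono) auto
    ultimately show ?thesis by simp
  qed
  also have "\<dots> \<le> 2 * \<delta>\<^sup>2 + 2 * \<delta> * p + 2 * \<delta> * w"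
    using \<mu>'(2) \<mu>(1) by (simp add: distrib_left)
  \<comment> \<open>Completing the squares confines \<open>(p, w)\<close> to a disc of radius
    \<open>2 * \<delta>\<close> about \<open>(\<delta>, \<delta>)\<close>, so both are at most
    \<open>3 * \<delta>\<close>.\<close>
  finally have sq: "(p - \<delta>)\<^sup>2 + (w - \<delta>)\<^sup>2 \<le> (2 * \<delta>)\<^sup>2"
    by (simp add: power2_eq_square algebra_simps)
  have "(p - \<delta>)\<^sup>2 \<le> (2 * \<delta>)\<^sup>2" "(w - \<delta>)\<^sup>2 \<le> (2 * \<delta>)\<^sup>2"
    using sq zero_le_power2[of "p - \<delta>"] zero_le_power2[of "w - \<delta>"] by linarith+
  then have "p - \<delta> \<le> 2 * \<delta>" "w - \<delta> \<le> 2 * \<delta>"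
    using \<delta> power2_le_imp_le[of _ "2 * \<delta>"] by auto
  then have "t * w + p \<le> t * (3 * \<delta>) + 3 * \<delta>"
    using t by (intro add_mono mult_left_mono) auto
  also have "\<dots> = \<delta> * (3 * (t + 1))" by (simp add: algebra_simps)
  also have "\<dots> = r" using t by (simp add: \<delta>_def)
  finally show ?thesis using disp order_trans by blast
qed

subsection \<open>Inexact iterations of firmly nonexpansive maps\<close>

text \<open>Subtracting the accumulated errors leaves a decreasing sequence, bounded below by minus
  the total error.\<close>

lemma quasi_monotone_convergent:
  fixes a e :: "nat \<Rightarrow> real"
  assumes step: "\<And>k. a (Suc k) \<le> a k + e k" and nonneg: "\<And>k. 0 \<le> a k"
    and e: "\<And>k. 0 \<le> e k" "summable e"
  shows "convergent a"
proof -
  define c where "c k = a k - sum e {..<k}" for k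
  have "decseq c"
    using step by (intro decseq_SucI) (simp add: c_def algebra_simps)
  moreover have "- suminf e \<le> c k" for k
    using nonneg[of k] sum_le_suminf[OF e(2), of "{..<k}"] e(1) by (auto simp: c_def)
  ultimately obtain L where L: "c \<longlonglongrightarrow> L" using decseq_convergent by metis
  have "(\<lambda>k. c k + sum e {..<k}) \<longlonglongrightarrow> L + suminf e"
    by (intro tendsto_add L summable_LIMSEQ e)
  then show ?thesis by (simp add: c_def convergentI)
qed

text \<open>In inner product spaces equivalent to
  \<open>norm (F x - F y) ^ 2 \<le> (F x - F y) \<bullet> (x - y)\<close>; this form keeps the
  displacements visible.\<close>

definition firmly_nonexpansive :: "('a::real_normed_vector \<Rightarrow> 'a) \<Rightarrow> bool" where
  "firmly_nonexpansive F \<longleftrightarrow>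
     (\<forall>x y. (norm (F x - F y))\<^sup>2 + (norm ((x - F x) - (y - F y)))\<^sup>2 \<le> (norm (x - y))\<^sup>2)"

lemma firmly_nonexpansiveD:
  assumes "firmly_nonexpansive F"
  shows "(norm (F x - F y))\<^sup>2 + (norm ((x - F x) - (y - F y)))\<^sup>2 \<le> (norm (x - y))\<^sup>2"
    and "norm (F x - F y) \<le> norm (x - y)"
    and "norm ((x - F x) - (y - F y)) \<le> norm (x - y)"
proof -
  show *: "(norm (F x - F y))\<^sup>2 + (norm ((x - F x) - (y - F y)))\<^sup>2 \<le> (norm (x - y))\<^sup>2"
    using assms by (simp add: firmly_nonexpansive_def)
  have "(norm (F x - F y))\<^sup>2 \<le> (norm (x - y))\<^sup>2"
    "(norm ((x - F x) - (y - F y)))\<^sup>2 \<le> (norm (x - y))\<^sup>2"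
    using * zero_le_power2[of "norm (F x - F y)"] zero_le_power2[of "norm ((x - F x) - (y - F y))"]
    by linarith+
  then show "norm (F x - F y) \<le> norm (x - y)" "norm ((x - F x) - (y - F y)) \<le> norm (x - y)"
    by (auto intro: power2_le_imp_le)
qed

text \<open>The distance to the exact orbit of an almost fixed point converges, and firm nonexpansiveness
  turns this into the vanishing of the difference of the two displacements.\<close>

lemma inexact_displacement_tendsto_0:
  fixes F :: "'a::real_normed_vector \<Rightarrow> 'a"
  assumes F: "firmly_nonexpansive F"
    and inf: "\<And>r. r > 0 \<Longrightarrow> \<exists>z. norm (z - F z) \<le> r"
    and e: "summable (\<lambda>k. norm (v (Suc k) - F (v k)))"
  shows "(\<lambda>k. v k - F (v k)) \<longlonglongrightarrow> 0"
proof (rule LIMSEQ_I)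
  fix r :: real assume r: "0 < r"
  obtain z where z: "norm (z - F z) \<le> r / 2" using inf[of "r / 2"] r by auto
  define y where "y k = (F ^^ k) z" for k
  have ySuc: "y (Suc k) = F (y k)" for k by (simp add: y_def)
  have disp: "norm (y k - F (y k)) \<le> r / 2" for k
  proof (induction k)
    case (Suc k)
    have "norm (y (Suc k) - F (y (Suc k))) \<le> norm (y k - y (Suc k))"
      using firmly_nonexpansiveD(2)[OF F, of "y k" "y (Suc k)"] by (simp add: ySuc)
    then show ?case using Suc by (simp add: ySuc)
  qed (use z in \<open>simp add: y_def\<close>)
  define d where "d k = norm (v k - y k)" for k
  define n where "n k = norm (F (v k) - F (y k))" for k
  define \<epsilon> where "\<epsilon> k = norm (v (Suc k) - F (v k))" for k
  have \<epsilon>: "summable \<epsilon>" "\<And>k. 0 \<le> \<epsilon> k" using e by (auto simp: \<epsilon>_def[abs_def])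
  have n_le: "n k \<le> d k" for k
    using firmly_nonexpansiveD(2)[OF F, of "v k" "y k"] by (simp add: n_def d_def)
  have d_le: "d (Suc k) \<le> n k + \<epsilon> k" for k
    unfolding d_def n_def \<epsilon>_def ySuc by norm
  have "convergent d"
  proof (rule quasi_monotone_convergent)
    show "d (Suc k) \<le> d k + \<epsilon> k" for k using n_le[of k] d_le[of k] by linarith
  qed (use \<epsilon> in \<open>auto simp: d_def\<close>)
  then obtain L where L: "d \<longlonglongrightarrow> L" by (auto simp: convergent_def)
  have "(\<lambda>k. d (Suc k) - \<epsilon> k) \<longlonglongrightarrow> L - 0"
    by (intro tendsto_diff LIMSEQ_Suc L summable_LIMSEQ_zero \<epsilon>)
  \<comment> \<open>\<open>n k\<close> is squeezed between \<open>d (Suc k) - \<epsilon> k\<close>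
    and \<open>d k\<close>. A common limit makes the difference of squares vanish, which bounds the
    squared difference of displacements.\<close>
  then have "n \<longlonglongrightarrow> L"
    using L n_le d_le
    by (intro tendsto_sandwich[of "\<lambda>k. d (Suc k) - \<epsilon> k" n sequentially d]) (auto simp: diff_le_eq)
  then have "(\<lambda>k. (d k)\<^sup>2 - (n k)\<^sup>2) \<longlonglongrightarrow> L\<^sup>2 - L\<^sup>2"
    by (intro tendsto_intros L)
  then have "(\<lambda>k. sqrt ((d k)\<^sup>2 - (n k)\<^sup>2)) \<longlonglongrightarrow> sqrt 0"
    by (intro tendsto_real_sqrt) simp
  then obtain k0 where k0: "\<And>k. k \<ge> k0 \<Longrightarrow> norm (sqrt ((d k)\<^sup>2 - (n k)\<^sup>2) - 0) < r / 2"
    using LIMSEQ_D[of _ "0::real" "r / 2"] r by (auto simp: real_sqrt_zero)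
  have "norm (v k - F (v k) - 0) < r" if "k \<ge> k0" for k
  proof -
    have "(norm ((v k - F (v k)) - (y k - F (y k))))\<^sup>2 \<le> (d k)\<^sup>2 - (n k)\<^sup>2"
      using firmly_nonexpansiveD(1)[OF F, of "v k" "y k"] by (simp add: n_def d_def)
    then have "norm ((v k - F (v k)) - (y k - F (y k))) \<le> sqrt ((d k)\<^sup>2 - (n k)\<^sup>2)"
      by (rule real_le_rsqrt)
    also have "\<dots> < r / 2" using k0[OF that] by simp
    finally have "norm ((v k - F (v k)) - (y k - F (y k))) < r / 2" .
    then show ?thesis
      using disp[of k] norm_triangle_ineq2[of "v k - F (v k)" "y k - F (y k)"] by simp
  qed
  then show "\<exists>no. \<forall>k\<ge>no. norm (v k - F (v k) - 0) < r" by blast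
qed

text \<open>Distances to fixed points converge, so \<open>v\<close> is bounded. A cluster point is
  fixed, as displacements vanish and \<open>F\<close> is continuous; the distance to it converges
  and tends to 0 along a subsequence, hence tends to 0.\<close>

lemma inexact_iteration_converges:
  fixes F :: "'a::euclidean_space \<Rightarrow> 'a"
  assumes F: "firmly_nonexpansive F" and u: "F u = u"
    and e: "summable (\<lambda>k. norm (v (Suc k) - F (v k)))"
  obtains w where "F w = w" "v \<longlonglongrightarrow> w"
proof -
  \<comment> \<open>Applied to \<open>u\<close> for boundedness and later to the cluster
    point.\<close>
  have conv: "convergent (\<lambda>k. norm (v k - w))" if w: "F w = w" for w
  proof (rule quasi_monotone_convergent)
    show "norm (v (Suc k) - w) \<le> norm (v k - w) + norm (v (Suc k) - F (v k))" for k
    proof -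
      have "norm (F (v k) - w) \<le> norm (v k - w)"
        using firmly_nonexpansiveD(2)[OF F, of "v k" w] w by simp
      then show ?thesis by norm
    qed
  qed (use e in auto)
  have disp: "(\<lambda>k. v k - F (v k)) \<longlonglongrightarrow> 0"
    by (rule inexact_displacement_tendsto_0[OF F _ e]) (metis u diff_self norm_zero less_imp_le)
  have "Bseq (\<lambda>k. norm (v k - u))"
    by (rule convergent_imp_Bseq[OF conv[OF u]])
  then obtain B where B: "\<And>k. norm (v k - u) \<le> B" by (auto simp: Bseq_def)
  have "bounded (range v)"
    unfolding bounded_def using B by (intro exI[of _ u] exI[of _ B]) (auto simp: dist_norm norm_minus_commute)
  then obtain w \<phi> where w: "strict_mono (\<phi> :: nat \<Rightarrow> nat)" "(v \<circ> \<phi>) \<longlonglongrightarrow> w"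
    using bounded_imp_convergent_subsequence by blast
  have "continuous_on UNIV F"
    by (rule lipschitz_on_continuous_on[of 1]) (auto intro!: lipschitz_onI simp: dist_norm firmly_nonexpansiveD(2)[OF F])
  then have "(\<lambda>k. F ((v \<circ> \<phi>) k)) \<longlonglongrightarrow> F w"
    by (rule continuous_on_tendsto_compose[OF _ w(2)]) auto
  then have "(\<lambda>k. (v \<circ> \<phi>) k - F ((v \<circ> \<phi>) k)) \<longlonglongrightarrow> w - F w"
    by (intro tendsto_diff w(2))
  moreover have "(\<lambda>k. (v \<circ> \<phi>) k - F ((v \<circ> \<phi>) k)) \<longlonglongrightarrow> 0"
    using LIMSEQ_subseq_LIMSEQ[OF disp w(1)] by (simp add: o_def)
  ultimately have fw: "F w = w" using LIMSEQ_unique by fastforce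
  obtain L where L: "(\<lambda>k. norm (v k - w)) \<longlonglongrightarrow> L" using conv[OF fw] by (auto simp: convergent_def)
  then have "((\<lambda>k. norm (v k - w)) \<circ> \<phi>) \<longlonglongrightarrow> L" by (rule LIMSEQ_subseq_LIMSEQ[OF _ w(1)])
  moreover have "((\<lambda>k. norm (v k - w)) \<circ> \<phi>) \<longlonglongrightarrow> 0"
    using tendsto_norm_zero[OF LIM_zero[OF w(2)]] by (simp add: o_def)
  ultimately have "L = 0" by (rule LIMSEQ_unique)
  then have "(\<lambda>k. v k - w) \<longlonglongrightarrow> 0" using L tendsto_norm_zero_iff by blast
  then have "v \<longlonglongrightarrow> w" by (rule LIM_zero_cancel)
  with fw show ?thesis by (rule that)
qed

subsection \<open>Anderson acceleration steps\<close>

text \<open>Abel summation: \<open>\<gamma> i\<close> enters the weights \<open>i\<close> and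
  \<open>i + 1\<close> with opposite signs, and the last weight carries an extra 1.\<close>

lemma sum_aa_weight:
  fixes x :: "nat \<Rightarrow> 'a::real_vector"
  shows "(\<Sum>j\<le>M. aa_weight M \<gamma> j *\<^sub>R x j) = x M - (\<Sum>i<M. \<gamma> i *\<^sub>R (x (Suc i) - x i))"
proof -
  \<comment> \<open>One formula covers first, inner and last weights, and also
    \<open>M = 0\<close>.\<close>
  have "(\<Sum>j\<le>M. aa_weight M \<gamma> j *\<^sub>R x j) =
      (\<Sum>j\<le>M. (if j = M then x j else 0) + (if j < M then \<gamma> j *\<^sub>R x j else 0)
         - (case j of 0 \<Rightarrow> 0 | Suc i \<Rightarrow> \<gamma> i *\<^sub>R x (Suc i)))"
    by (intro sum.cong) (auto simp: aa_weight_def algebra_simps split: nat.split)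
  also have "\<dots> = x M + (\<Sum>j<M. \<gamma> j *\<^sub>R x j) - (\<Sum>i<M. \<gamma> i *\<^sub>R x (Suc i))"
  proof -
    have "(\<Sum>j\<le>M. if j < M then \<gamma> j *\<^sub>R x j else 0) = (\<Sum>j<M. \<gamma> j *\<^sub>R x j)"
      by (intro sum.mono_neutral_cong_right) auto
    moreover have "(\<Sum>j\<le>M. case j of 0 \<Rightarrow> 0 | Suc i \<Rightarrow> \<gamma> i *\<^sub>R x (Suc i)) = (\<Sum>i<M. \<gamma> i *\<^sub>R x (Suc i))"
      by (cases M) (simp_all add: sum.atMost_Suc_shift lessThan_Suc_atMost del: sum.atMost_Suc)
    ultimately show ?thesis by (simp add: sum.distrib sum_subtractf)
  qed
  finally show ?thesis by (simp add: scaleR_diff_right sum_subtractf)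
qed

text \<open>Only the comparison of the minimiser with the zero vector is needed: it bounds the
  regularisation term by \<open>\<parallel>g\<^sup>k\<parallel>\<^sup>2\<close>.\<close>

lemma aa_candidate_close:
  fixes F :: "'a::real_inner \<Rightarrow> 'a"
  assumes F: "firmly_nonexpansive F" and \<eta>: "\<eta> > 0"
    and opt: "is_arg_min (aa_objective F \<eta> Mmax v k) (\<lambda>_. True) \<gamma>"
  shows "norm (aa_candidate F Mmax v \<gamma> k - F (v k)) \<le> norm (resid F v k) / sqrt \<eta>"
proof -
  define M where "M = mem Mmax k"
  define s where "s i = v (k - M + Suc i) - v (k - M + i)" for i
  have Mk: "M \<le> k" by (simp add: M_def mem_def)
  have "aa_candidate F Mmax v \<gamma> k - F (v k)
      = - (\<Sum>i<M. \<gamma> i *\<^sub>R (F (v (k - M + Suc i)) - F (v (k - M + i))))"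
    unfolding aa_candidate_def Let_def M_def[symmetric] sum_aa_weight[of M \<gamma> "\<lambda>j. F (v (k - M + j))"]
    using Mk by simp
  then have "norm (aa_candidate F Mmax v \<gamma> k - F (v k))
      \<le> (\<Sum>i<M. norm (\<gamma> i *\<^sub>R (F (v (k - M + Suc i)) - F (v (k - M + i)))))"
    by (simp only: norm_minus_cancel norm_sum)
  also have "\<dots> \<le> (\<Sum>i<M. \<bar>\<gamma> i\<bar> * norm (s i))"
    unfolding s_def norm_scaleR by (intro sum_mono mult_left_mono firmly_nonexpansiveD(2)[OF F]) auto
  finally have le: "norm (aa_candidate F Mmax v \<gamma> k - F (v k)) \<le> (\<Sum>i<M. \<bar>\<gamma> i\<bar> * norm (s i))" .
  \<comment> \<open>Cauchy-Schwarz yields the product \<open>GG * SS\<close>, which the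
    regularisation term controls.\<close>
  have cs: "(\<Sum>i<M. \<bar>\<gamma> i\<bar> * norm (s i))\<^sup>2 \<le> (\<Sum>i<M. (\<gamma> i)\<^sup>2) * (\<Sum>i<M. (norm (s i))\<^sup>2)"
    using Cauchy_Schwarz_ineq_sum[of "\<lambda>i. \<bar>\<gamma> i\<bar>" "\<lambda>i. norm (s i)" "{..<M}"] by simp
  define SS where "SS = (\<Sum>i<M. (norm (s i))\<^sup>2)"
  define YY where "YY = (\<Sum>i<M. (norm (Ycol F Mmax v k i))\<^sup>2)"
  define GG where "GG = (\<Sum>i<M. (\<gamma> i)\<^sup>2)"
  have pos: "0 \<le> SS" "0 \<le> YY" "0 \<le> GG" by (auto simp: SS_def YY_def GG_def intro: sum_nonneg)
  have Scol: "Scol Mmax v k i = s i" for i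
    by (simp add: Scol_def s_def M_def Let_def)
  have "aa_objective F \<eta> Mmax v k \<gamma> \<le> aa_objective F \<eta> Mmax v k (\<lambda>_. 0)"
    using opt by (auto simp: is_arg_min_def not_less)
  moreover have "aa_objective F \<eta> Mmax v k (\<lambda>_. 0) = (norm (resid F v k))\<^sup>2"
    by (simp add: aa_objective_def)
  moreover have "\<eta> * (SS + YY) * GG \<le> aa_objective F \<eta> Mmax v k \<gamma>"
    by (simp add: aa_objective_def M_def[symmetric] Scol SS_def YY_def GG_def)
  moreover have "\<eta> * SS * GG \<le> \<eta> * (SS + YY) * GG"
    using pos \<eta> by (intro mult_right_mono mult_left_mono) auto
  ultimately have "\<eta> * SS * GG \<le> (norm (resid F v k))\<^sup>2" by linarith
  then have "GG * SS \<le> (norm (resid F v k))\<^sup>2 / \<eta>"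
    using \<eta> by (simp add: field_simps)
  then have "(\<Sum>i<M. \<bar>\<gamma> i\<bar> * norm (s i))\<^sup>2 \<le> (norm (resid F v k) / sqrt \<eta>)\<^sup>2"
    using cs \<eta> by (simp add: GG_def SS_def power_divide)
  then have "(\<Sum>i<M. \<bar>\<gamma> i\<bar> * norm (s i)) \<le> norm (resid F v k) / sqrt \<eta>"
    by (rule power2_le_imp_le) (use \<eta> in simp)
  then show ?thesis using le by linarith
qed

section \<open>The safeguard and summability of the errors\<close>

lemma A2DR_step:
  assumes run: "A2DR_run F \<eta> D \<epsilon> R Mmax v0 v \<gamma> nAA RAA I" and k: "k \<ge> 1"
  shows "is_arg_min (aa_objective F \<eta> Mmax v k) (\<lambda>_. True) (\<gamma> k)"
    and "AA_adopted F D \<epsilon> R v nAA RAA I k \<Longrightarrow>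
           v (Suc k) = aa_candidate F Mmax v (\<gamma> k) k \<and> nAA (Suc k) = Suc (nAA k)"
    and "\<not> AA_adopted F D \<epsilon> R v nAA RAA I k \<Longrightarrow>
           v (Suc k) = F (v k) \<and> nAA (Suc k) = nAA k \<and> I (Suc k)"
    and "I k \<or> RAA k \<ge> R \<Longrightarrow> safeguard F D \<epsilon> R v (nAA k) k \<Longrightarrow> RAA (Suc k) = 1"
    and "\<not> (I k \<or> RAA k \<ge> R) \<Longrightarrow> RAA (Suc k) = Suc (RAA k)"
  using run k by (auto simp: A2DR_run_def AA_adopted_def split: if_splits)

text \<open>Iteration 0 and rejected iterations take the exact step;
  \<open>aa_candidate_close\<close> covers the adopted ones.\<close>

lemma A2DR_error_le:
  assumes F: "firmly_nonexpansive F" and \<eta>: "\<eta> > 0"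
    and run: "A2DR_run F \<eta> D \<epsilon> R Mmax v0 v \<gamma> nAA RAA I"
  shows "norm (v (Suc k) - F (v k)) \<le> norm (resid F v k) / sqrt \<eta>"
proof (cases "k \<ge> 1 \<and> AA_adopted F D \<epsilon> R v nAA RAA I k")
  case True
  then show ?thesis
    using aa_candidate_close[OF F \<eta>] A2DR_step(1,2)[OF run] by auto
next
  case False
  have "v (Suc k) = F (v k)"
  proof (cases "k \<ge> 1")
    case True
    then show ?thesis using False A2DR_step(3)[OF run] by auto
  next
    case False
    then have "k = 0" by simp
    then show ?thesis using run by (simp add: A2DR_run_def)
  qed
  then show ?thesis using \<eta> by simp
qed

text \<open>The displacement map is nonexpansive, so the residual changes by at most the step
  length, itself at most residual plus error. This controls the accelerated steps taken without a
  safeguard test.\<close>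

lemma A2DR_residual_growth:
  assumes F: "firmly_nonexpansive F" and \<eta>: "\<eta> > 0"
    and run: "A2DR_run F \<eta> D \<epsilon> R Mmax v0 v \<gamma> nAA RAA I"
  shows "norm (resid F v (Suc k)) \<le> (2 + 1 / sqrt \<eta>) * norm (resid F v k)"
proof -
  have "norm (resid F v (Suc k) - resid F v k) \<le> norm (v (Suc k) - v k)"
    unfolding resid_def by (rule firmly_nonexpansiveD(3)[OF F])
  also have "v (Suc k) - v k = (v (Suc k) - F (v k)) - resid F v k" by (simp add: resid_def)
  then have "norm (v (Suc k) - v k) \<le> norm (v (Suc k) - F (v k)) + norm (resid F v k)"
    by (metis norm_triangle_ineq4)
  finally have "norm (resid F v (Suc k))
      \<le> norm (resid F v k) + (norm (v (Suc k) - F (v k)) + norm (resid F v k))"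
    using norm_triangle_ineq2[of "resid F v (Suc k)" "resid F v k"] by linarith
  then show ?thesis using A2DR_error_le[OF F \<eta> run, of k] by (simp add: algebra_simps)
qed

text \<open>The last passed test lies at most \<open>R\<close> steps back. Its bound is carried
  forward at the cost of a power of the growth factor and a lag in the counter, which the divisor
  \<open>2 * real R\<close> absorbs.\<close>

lemma A2DR_adopted_residual_le:
  assumes F: "firmly_nonexpansive F" and \<eta>: "\<eta> > 0" and D: "D > 0" and \<epsilon>: "\<epsilon> > 0" and R: "R \<ge> 1"
    and run: "A2DR_run F \<eta> D \<epsilon> R Mmax v0 v \<gamma> nAA RAA I"
    and adopted: "AA_adopted F D \<epsilon> R v nAA RAA I k"
  shows "norm (resid F v k) \<le> (2 + 1 / sqrt \<eta>) ^ R * (D * norm (resid F v 0))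
      * ((real (nAA k) + 1) / (2 * real R)) powr (- (1 + \<epsilon>))"
proof -
  define L where "L = 2 + 1 / sqrt \<eta>"
  define G where "G = D * norm (resid F v 0)"
  define g where "g k = norm (resid F v k)" for k
  \<comment> \<open>Bound \<open>j\<close> adopted steps after a passed test: the counter is now
    \<open>n\<close> and was \<open>n - j\<close> at the test.\<close>
  define B where "B n j = L ^ j * G * (real (n - j) / real R + 1) powr (- (1 + \<epsilon>))" for n j
  have L: "L \<ge> 1" using \<eta> by (simp add: L_def)
  have G: "G \<ge> 0" using D by (simp add: G_def)
  have growth: "g (Suc k) \<le> L * g k" for k
    unfolding g_def L_def by (rule A2DR_residual_growth[OF F \<eta> run])
  have safe: "g k \<le> B (nAA k) 0" if "safeguard F D \<epsilon> R v (nAA k) k" for k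
    using that by (simp add: safeguard_def g_def B_def G_def)
  \<comment> \<open>When \<open>I k\<close> is False, the last test was passed \<open>RAA k\<close>
    steps ago; \<open>RAA k \<le> nAA k\<close> keeps the natural subtraction in \<open>B\<close>
    exact.\<close>
  have run_bound: "1 \<le> RAA k \<and> RAA k \<le> R \<and> RAA k \<le> nAA k \<and> g k \<le> B (nAA k) (RAA k)"
    if "k \<ge> 1" "\<not> I k" for k
    using that
  proof (induction k rule: dec_induct)
    case base
    then show ?case using run by (simp add: A2DR_run_def)
  next
    case (step k)
    have ad: "AA_adopted F D \<epsilon> R v nAA RAA I k"
      using A2DR_step(3)[OF run \<open>1 \<le> k\<close>] step.prems by blast
    then have n: "nAA (Suc k) = Suc (nAA k)"
      using A2DR_step(2)[OF run \<open>1 \<le> k\<close>] by blast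
    have grow: "g (Suc k) \<le> B (Suc (nAA k)) (Suc j)" if "g k \<le> B (nAA k) j" for j
    proof -
      have "g (Suc k) \<le> L * B (nAA k) j"
        using growth[of k] that L by (meson mult_left_mono order_trans zero_le_one)
      then show ?thesis by (simp add: B_def mult.assoc)
    qed
    show ?case
    proof (cases "I k \<or> RAA k \<ge> R")
      case True
      then have s: "safeguard F D \<epsilon> R v (nAA k) k" using ad by (auto simp: AA_adopted_def)
      then have "RAA (Suc k) = 1" using A2DR_step(4)[OF run \<open>1 \<le> k\<close> True] by blast
      then show ?thesis using grow[of 0] safe[OF s] n R by simp
    next
      case False
      then have "RAA (Suc k) = Suc (RAA k)" using A2DR_step(5)[OF run \<open>1 \<le> k\<close>] by blast
      then show ?thesis using grow[of "RAA k"] step.IH False n by simp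
    qed
  qed
  obtain j where j: "j \<le> R" "j \<le> nAA k" "g k \<le> B (nAA k) j"
  proof (cases "I k \<or> RAA k \<ge> R")
    case True
    then show ?thesis using that[of 0] safe adopted by (auto simp: AA_adopted_def)
  next
    case False
    then show ?thesis using that[of "RAA k"] run_bound[of k] adopted by (auto simp: AA_adopted_def)
  qed
  \<comment> \<open>Eliminates \<open>j\<close>: for \<open>j\<close> at most \<open>n\<close> and
    \<open>R\<close>, with \<open>R \<ge> 1\<close>, one has
    \<open>n + 1 \<le> 2 * (n - j) + 2 * R\<close>.\<close>
  have "(real (nAA k) + 1) / (2 * real R) \<le> real (nAA k - j) / real R + 1"
  proof -
    have "real (nAA k) + 1 \<le> 2 * real (nAA k - j) + 2 * real R"
      using j(1,2) R by (simp add: of_nat_diff)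
    then have "(real (nAA k) + 1) / (2 * real R)
        \<le> (2 * real (nAA k - j) + 2 * real R) / (2 * real R)"
      using R by (intro divide_right_mono) auto
    also have "\<dots> = real (nAA k - j) / real R + 1"
      using R by (simp add: add_divide_distrib)
    finally show ?thesis .
  qed
  moreover have "0 < (real (nAA k) + 1) / (2 * real R)" using R by simp
  ultimately have decay: "(real (nAA k - j) / real R + 1) powr (- (1 + \<epsilon>))
      \<le> ((real (nAA k) + 1) / (2 * real R)) powr (- (1 + \<epsilon>))"
    using \<epsilon> by (intro powr_mono2') auto
  have "L ^ j * G \<le> L ^ R * G"
    using L G j(1) by (intro mult_right_mono power_increasing) auto
  then have "B (nAA k) j \<le> L ^ R * G * ((real (nAA k) + 1) / (2 * real R)) powr (- (1 + \<epsilon>))"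
    unfolding B_def using decay L G by - (rule mult_mono, auto)
  then show ?thesis using j(3) unfolding L_def G_def g_def by linarith
qed

text \<open>The counter \<open>nAA\<close> is injective on the adopted iterations, so their errors are dominated by a
  convergent \<open>p\<close>-series.\<close>

lemma A2DR_errors_summable:
  assumes F: "firmly_nonexpansive F" and \<eta>: "\<eta> > 0" and D: "D > 0" and \<epsilon>: "\<epsilon> > 0" and R: "R \<ge> 1"
    and run: "A2DR_run F \<eta> D \<epsilon> R Mmax v0 v \<gamma> nAA RAA I"
  shows "summable (\<lambda>k. norm (v (Suc k) - F (v k)))"
proof -
  define e where "e k = norm (v (Suc k) - F (v k))" for k
  define B where "B = (2 + 1 / sqrt \<eta>) ^ R * (D * norm (resid F v 0))
      * (1 / (2 * real R)) powr (- (1 + \<epsilon>)) / sqrt \<eta>"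
  define c where "c i = B * real (Suc i) powr (- (1 + \<epsilon>))" for i
  have B: "0 \<le> B" using \<eta> D by (simp add: B_def)
  have "summable (\<lambda>i. real i powr (- (1 + \<epsilon>)))" using \<epsilon> by (simp add: summable_real_powr_iff)
  then have c: "summable c"
    unfolding c_def[abs_def] by (intro summable_mult) (subst summable_Suc_iff)
  have e_le: "e k \<le> c (nAA k)" if "AA_adopted F D \<epsilon> R v nAA RAA I k" for k
  proof -
    have "e k \<le> norm (resid F v k) / sqrt \<eta>"
      unfolding e_def by (rule A2DR_error_le[OF F \<eta> run])
    also have "\<dots> \<le> (2 + 1 / sqrt \<eta>) ^ R * (D * norm (resid F v 0))
      * ((real (nAA k) + 1) / (2 * real R)) powr (- (1 + \<epsilon>)) / sqrt \<eta>"
      by (intro divide_right_mono A2DR_adopted_residual_le[OF F \<eta> D \<epsilon> R run that]) (use \<eta> in auto)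
    also have "(real (nAA k) + 1) / (2 * real R) = 1 / (2 * real R) * real (Suc (nAA k))" by simp
    also have "\<dots> powr (- (1 + \<epsilon>))
        = (1 / (2 * real R)) powr (- (1 + \<epsilon>)) * real (Suc (nAA k)) powr (- (1 + \<epsilon>))"
      by (rule powr_mult)
    finally show ?thesis by (simp add: c_def B_def)
  qed
  \<comment> \<open>Each adopted iteration uses the term of \<open>c\<close> at the current counter
    and advances it; rejected ones add 0. The shift leaves out iteration 0, which precedes the
    counter.\<close>
  have "(\<Sum>k<K. e (Suc k)) \<le> sum c {..<nAA (Suc K)}" for K
  proof (induction K)
    case (Suc K)
    show ?case
    proof (cases "AA_adopted F D \<epsilon> R v nAA RAA I (Suc K)")
      case True
      then show ?thesis using Suc e_le[OF True] A2DR_step(2)[OF run _ True] by simp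
    next
      case False
      then show ?thesis using Suc A2DR_step(3)[OF run _ False] by (simp add: e_def)
    qed
  qed (use B in \<open>simp add: c_def sum_nonneg\<close>)
  moreover have "sum c {..<n} \<le> suminf c" for n
    using c B by (intro sum_le_suminf) (auto simp: c_def)
  ultimately have "(\<Sum>k<K. e (Suc k)) \<le> suminf c" for K using order_trans by blast
  then have "summable (\<lambda>k. e (Suc k))"
    by (intro summableI_nonneg_bounded[of _ "suminf c"]) (auto simp: e_def)
  then have "summable e" by (simp only: summable_Suc_iff)
  then show ?thesis by (simp add: e_def[abs_def])
qed

text \<open>Otherwise the counter freezes and all late residuals exceed a fixed threshold, against
  the limit 0. If the initial residual vanishes, all residuals do, and the test holds with
  equality.\<close>

lemma A2DR_adopted_infinite:
  assumes F: "firmly_nonexpansive F" and \<eta>: "\<eta> > 0" and D: "D > 0"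
    and run: "A2DR_run F \<eta> D \<epsilon> R Mmax v0 v \<gamma> nAA RAA I"
    and lim: "(\<lambda>k. resid F v k) \<longlonglongrightarrow> 0"
  shows "infinite {k. AA_adopted F D \<epsilon> R v nAA RAA I k}"
proof
  assume "finite {k. AA_adopted F D \<epsilon> R v nAA RAA I k}"
  then obtain K0 where "\<And>k. AA_adopted F D \<epsilon> R v nAA RAA I k \<Longrightarrow> k \<le> K0"
    by (auto simp: finite_nat_set_iff_bounded_le)
  then obtain K where K: "K \<ge> 1" "\<And>k. k \<ge> K \<Longrightarrow> \<not> AA_adopted F D \<epsilon> R v nAA RAA I k"
    using that[of "Suc K0"] by force
  have n: "nAA k = nAA K" if "k \<ge> K" for k
    using that
  proof (induction k rule: dec_induct)
    case (step k)
    then show ?case using A2DR_step(3)[OF run _ K(2)[of k]] K(1) by auto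
  qed simp
  define \<theta> where "\<theta> = D * norm (resid F v 0) * (real (nAA K) / real R + 1) powr (- (1 + \<epsilon>))"
  have above: "\<theta> < norm (resid F v k)" if "k \<ge> K" for k
    using K(2)[OF that] K(1) that n[OF that]
    by (auto simp: AA_adopted_def safeguard_def \<theta>_def not_le)
  show False
  proof (cases "resid F v 0 = 0")
    case True
    have "resid F v k = 0" for k
    proof (induction k)
      case (Suc k)
      then show ?case using A2DR_residual_growth[OF F \<eta> run, of k] by simp
    qed (rule True)
    then show False using above[of K] True by (simp add: \<theta>_def)
  next
    case False
    have "0 < real (nAA K) / real R + 1" by (simp add: add_nonneg_pos)
    then have "0 < \<theta>" using D False by (simp add: \<theta>_def)
    then obtain k0 where k0: "\<And>k. k \<ge> k0 \<Longrightarrow> norm (resid F v k) < \<theta>"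
      using LIMSEQ_D[OF lim, of \<theta>] by auto
    then show False using above[of "max K k0"] k0[of "max K k0"] by (meson less_asym max.cobounded1 max.cobounded2)
  qed
qed

theorem theorem4p3:
  fixes blk :: "'n::finite \<Rightarrow> 'b::finite"
    and fs :: "'b \<Rightarrow> real^'n \<Rightarrow> ereal"
    and f :: "real^'n \<Rightarrow> ereal"
    and A :: "real^'n^'m" and b :: "real^'m"
    and t \<eta> D \<epsilon> :: real and R Mmax :: nat
    and v0 :: "real^'n" and v :: "nat \<Rightarrow> real^'n"
    and \<gamma> :: "nat \<Rightarrow> nat \<Rightarrow> real" and nAA RAA :: "nat \<Rightarrow> nat" and I :: "nat \<Rightarrow> bool"
  assumes "\<And>i. convex_closed_proper_on (block_space blk i) (fs i)"
    and "f = separable blk fs"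
    and "\<exists>x. A *v x = b"
    and "solvable f A b"
    and "t > 0" and "\<eta> > 0" and "D > 0" and "\<epsilon> > 0" and "R \<ge> 1"
    and "A2DR_run (F_DRS t f A b) \<eta> D \<epsilon> R Mmax v0 v \<gamma> nAA RAA I"
  shows "liminf (\<lambda>k. ereal (norm (residual t f A b (v k)))) = 0
       \<and> infinite {k. AA_adopted (F_DRS t f A b) D \<epsilon> R v nAA RAA I k}
       \<and> ((\<exists>u. F_DRS t f A b u = u) \<longrightarrow>
            (\<exists>w. F_DRS t f A b w = w \<and> v \<longlonglongrightarrow> w)
          \<and> (\<exists>x. is_solution f A b x \<and> (\<lambda>k. prox t f (v k)) \<longlonglongrightarrow> x))"
proof -
  have ccp: "convex_closed_proper_on UNIV f"
    unfolding assms(2) by (rule separable_convex_closed_proper) (rule assms(1))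
  note t = \<open>t > 0\<close> and run = assms(10)
  obtain x0 where x0: "A *v x0 = b" using assms(3) by blast
  let ?F = "F_DRS t f A b"
  have F: "firmly_nonexpansive ?F"
    unfolding firmly_nonexpansive_def using DRS_firmly_nonexpansive[OF ccp t] by blast
  have errors: "summable (\<lambda>k. norm (v (Suc k) - ?F (v k)))"
    by (rule A2DR_errors_summable[OF F assms(6-9) run])
  have disp: "(\<lambda>k. v k - ?F (v k)) \<longlonglongrightarrow> 0"
    by (rule inexact_displacement_tendsto_0[OF F DRS_small_displacement[OF ccp assms(3,4) t] errors])
  have "(\<lambda>k. r_prim t f A b (v k)) \<longlonglongrightarrow> 0"
    unfolding residual_displacement(1)[OF x0]
    using bounded_linear.tendsto_zero[OF matrix_vector_mul_bounded_linear disp] .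
  moreover have "(\<lambda>k. r_dual t f A (v k)) \<longlonglongrightarrow> (1 / t) *\<^sub>R (0 - 0)"
    unfolding residual_displacement(2)[OF x0]
    by (intro tendsto_intros disp bounded_linear.tendsto_zero[OF _ disp])
      (simp add: linear_row_proj linear_linear)
  ultimately have "(\<lambda>k. residual t f A b (v k)) \<longlonglongrightarrow> (0, 0)"
    unfolding residual_def by (intro tendsto_Pair) auto
  then have "(\<lambda>k. norm (residual t f A b (v k))) \<longlonglongrightarrow> 0"
    using tendsto_norm by fastforce
  then have "(\<lambda>k. ereal (norm (residual t f A b (v k)))) \<longlonglongrightarrow> 0"
    by (simp add: zero_ereal_def)
  \<comment> \<open>The residual norms converge to 0, so the lower limit is a limit.\<close>
  then have "liminf (\<lambda>k. ereal (norm (residual t f A b (v k)))) = 0"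
    by (intro lim_imp_Liminf) auto
  moreover have "infinite {k. AA_adopted ?F D \<epsilon> R v nAA RAA I k}"
    by (rule A2DR_adopted_infinite[OF F assms(6,7) run]) (use disp in \<open>simp add: resid_def\<close>)
  moreover have "(\<exists>w. ?F w = w \<and> v \<longlonglongrightarrow> w) \<and> (\<exists>x. is_solution f A b x \<and> (\<lambda>k. prox t f (v k)) \<longlonglongrightarrow> x)"
    if u: "?F u = u" for u
  proof -
    obtain w where w: "?F w = w" "v \<longlonglongrightarrow> w"
      using inexact_iteration_converges[OF F u errors] by blast
    have "continuous_on UNIV (prox t f)"
      by (rule lipschitz_on_continuous_on[of 1])
        (auto intro!: lipschitz_onI simp: dist_norm prox_nonexpansive[OF ccp t])
    then have "(\<lambda>k. prox t f (v k)) \<longlonglongrightarrow> prox t f w"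
      by (rule continuous_on_tendsto_compose[OF _ w(2)]) auto
    moreover have "is_solution f A b (prox t f w)"
      by (rule DRS_fixed_point_solution[OF ccp t x0 w(1)])
    ultimately show ?thesis using w by blast
  qed
  ultimately show ?thesis by blast
qed

end
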